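(* (a) Let $w\in\{0,1\}^*$ be a finite nonempty word that is not a proper power, and let $a=10w^\infty\in X^\omega$. Then $$\mathrm{St}_F(a)=\langle x_2,\ x_3,\ y_1,\ y_2,\ w(x_1^{-1},\,x_1^{-1}x_0)\rangle .$$ (b) Let $b\in X^\omega$ be an arbitrary rational point different from $0^\infty$ and $1^\infty$, and let $b=vw^\infty$ be its unique decomposition as an eventually periodic word with a finite nonempty period $w\in X^*$ that is not a proper power and a finite (possibly empty) preperiod $v\in X^*$ such that the ending of $v$ differs from the one of $w$ (i.e. if $v$ is nonempty, the last letters of $v$ and $w$ are different). Then there is $h\in F$, which can be explicitly computed from the Schreier graph $\Gamma_b$, such that $h(b)=10w^\infty$ and $$\mathrm{St}_F(b)=\langle x_2^h,\ x_3^h,\ y_1^h,\ y_2^h,\ w(x_1^{-1},\,x_1^{-1}x_0)^h\rangle .$$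
   Context: Thompson's group $F$ is the group (under composition) of all strictly increasing piecewise linear homeomorphisms of $[0,1]$ onto itself that are differentiable except at finitely many dyadic rationals and whose slopes on intervals of differentiability are integer powers of $2$. Right-action convention: $(fg)(t)=g(f(t))$ (apply $f$ first), and $f^g=gfg^{-1}$. $F$ is generated by $x_0,x_1$, where $x_0(t)=t/2$ on $[0,\frac12]$, $t-\frac14$ on $[\frac12,\frac34]$, $2t-1$ on $[\frac34,1]$; $x_1(t)=t$ on $[0,\frac12]$, $\frac t2+\frac14$ on $[\frac12,\frac34]$, $t-\frac18$ on $[\frac34,\frac78]$, $2t-1$ on $[\frac78,1]$. For $n\ge 2$ put $x_n=x_0^{n-1}x_1x_0^{-(n-1)}$. Also $y_1=x_0^{-2}x_1x_0$ and $y_2=x_0^{-3}x_1x_0^{2}$. Let $X=\{0,1\}$, let $X^*$ be the set of finite words and $X^\omega$ the set of infinite words over $X$ (Cantor set). $F$ acts on $X^\omega$ via binary expansions; on generators, for every $u\in X^\omega$: $x_0:\ 0u\mapsto 00u,\ 10u\mapsto 01u,\ 11u\mapsto 1u$; $x_1:\ 0u\mapsto 0u,\ 10u\mapsto 100u,\ 110u\mapsto 101u,\ 111u\mapsto 11u$. A product $fg$ acts by applying $f$ first, then $g$. $\mathrm{St}_F(b)$ denotes the stabilizer of $b$ in $F$. A point of $X^\omega$ is rational if it is eventually periodic, i.e. of the form $vw^\infty$ with $v,w\in X^*$, $w$ nonempty, where $w^\infty=www\cdots$. A word is a proper power if it equals $u^k$ for some word $u$ and some $k\ge2$. For a word $w\in\{0,1\}^*$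 and $g_0,g_1\in F$, $w(g_0,g_1)$ is the element of $F$ obtained by replacing each letter $0$ of $w$ by $g_0$ and each letter $1$ by $g_1$ (keeping the left-to-right order). The Schreier graph $\Gamma_b$ is the oriented labeled graph whose vertex set is the $F$-orbit of $b$ in $X^\omega$, with an arrow labeled $s\in\{x_0,x_1\}$ from $c$ to $s(c)$ for each vertex $c$. That $h$ can be explicitly computed from $\Gamma_b$ means that $h$ is given as a word over $\{x_0,x_1,x_0^{-1},x_1^{-1}\}$ read along a path in $\Gamma_b$ starting at $b$ (arrows traversed backwards contribute inverse letters). *)

theory Defs
  imports
    "HOL-Analysis.Analysis"
    "HOL-Algebra.Group_Action"
    "HOL-Algebra.Generated_Groups"
    "HOL-Library.Stream"
begin

section \<open>Thompson's group F\<close>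

definition piecewise_linear01 :: "(real \<Rightarrow> real) \<Rightarrow> bool" where
  "piecewise_linear01 f \<longleftrightarrow>
    (\<exists>B. finite B \<and>
      (\<forall>p q. p < q \<and> {p<..<q} \<subseteq> {0..1} - B \<longrightarrow>
        (\<exists>m c. \<forall>t\<in>{p<..<q}. f t = m * t + c)))"

text \<open>Homeomorphisms of the unit interval are represented by functions on the reals that are
  the identity outside of it, so that every homeomorphism has exactly one representative.
  Differentiability is required at interior points of the interval only, so it does no harm that
  the library's \<open>dyadics\<close> are the nonnegative dyadic rationals.\<close>

definition thompson_carrier :: "(real \<Rightarrow> real) set" where
  "thompson_carrier = {f.
     (\<forall>t. t \<notin> {0..1} \<longrightarrow> f t = t) \<and>
     (\<exists>g. homeomorphism {0..1} {0..1} f g) \<and>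
     strict_mono_on {0..1} f \<and>
     piecewise_linear01 f \<and>
     (\<exists>D. finite D \<and> D \<subseteq> dyadics \<and>
       (\<forall>t\<in>{0<..<1} - D. \<exists>k::int. (f has_real_derivative 2 powi k) (at t)))}"

text \<open>Right-action convention: in a product the left factor is applied first.\<close>

definition thompsonF :: "(real \<Rightarrow> real) monoid" where
  "thompsonF = \<lparr>carrier = thompson_carrier, mult = (\<lambda>f g. g \<circ> f), one = id\<rparr>"

definition conjF :: "(real \<Rightarrow> real) \<Rightarrow> (real \<Rightarrow> real) \<Rightarrow> (real \<Rightarrow> real)" where
  "conjF f g = g \<otimes>\<^bsub>thompsonF\<^esub> f \<otimes>\<^bsub>thompsonF\<^esub> inv\<^bsub>thompsonF\<^esub> g"

definition x0 :: "real \<Rightarrow> real" where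
  "x0 t = (if t \<notin> {0..1} then t
           else if t \<le> 1/2 then t / 2
           else if t \<le> 3/4 then t - 1/4
           else 2 * t - 1)"

definition x1 :: "real \<Rightarrow> real" where
  "x1 t = (if t \<notin> {0..1} then t
           else if t \<le> 1/2 then t
           else if t \<le> 3/4 then t / 2 + 1/4
           else if t \<le> 7/8 then t - 1/8
           else 2 * t - 1)"

definition xn :: "nat \<Rightarrow> real \<Rightarrow> real" where
  "xn n = (if n = 0 then x0 else if n = 1 then x1 else
     x0 [^]\<^bsub>thompsonF\<^esub> (int n - 1) \<otimes>\<^bsub>thompsonF\<^esub> x1 \<otimes>\<^bsub>thompsonF\<^esub> x0 [^]\<^bsub>thompsonF\<^esub> (- (int n - 1)))"

definition y1 :: "real \<Rightarrow> real" where
  "y1 = x0 [^]\<^bsub>thompsonF\<^esub> (-2 :: int) \<otimes>\<^bsub>thompsonF\<^esub> x1 \<otimes>\<^bsub>thompsonF\<^esub> x0"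

definition y2 :: "real \<Rightarrow> real" where
  "y2 = x0 [^]\<^bsub>thompsonF\<^esub> (-3 :: int) \<otimes>\<^bsub>thompsonF\<^esub> x1 \<otimes>\<^bsub>thompsonF\<^esub> x0 [^]\<^bsub>thompsonF\<^esub> (2 :: int)"

definition prodF :: "(real \<Rightarrow> real) list \<Rightarrow> (real \<Rightarrow> real)" where
  "prodF gs = foldr (\<lambda>g h. g \<otimes>\<^bsub>thompsonF\<^esub> h) gs \<one>\<^bsub>thompsonF\<^esub>"


section \<open>Words and the Cantor set\<close>

text \<open>The letters 0 and 1 are \<open>False\<close> and \<open>True\<close>; the periodic word \<open>www...\<close> is \<open>cycle w\<close>.\<close>

definition word_subst :: "bool list \<Rightarrow> (real \<Rightarrow> real) \<Rightarrow> (real \<Rightarrow> real) \<Rightarrow> (real \<Rightarrow> real)" where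
  "word_subst w g0 g1 = prodF (map (\<lambda>c. if c then g1 else g0) w)"

definition proper_power :: "'a list \<Rightarrow> bool" where
  "proper_power w \<longleftrightarrow> (\<exists>u k. k \<ge> 2 \<and> w = concat (replicate k u))"

definition rational_point :: "bool stream \<Rightarrow> bool" where
  "rational_point b \<longleftrightarrow> (\<exists>v w. w \<noteq> [] \<and> b = v @- cycle w)"

definition canonical_decomposition :: "bool stream \<Rightarrow> bool list \<Rightarrow> bool list \<Rightarrow> bool" where
  "canonical_decomposition b v w \<longleftrightarrow>
     b = v @- cycle w \<and> w \<noteq> [] \<and> \<not> proper_power w \<and> (v \<noteq> [] \<longrightarrow> last v \<noteq> last w)"

definition bin_val :: "bool stream \<Rightarrow> real" where
  "bin_val u = (\<Sum>n. of_bool (u !! n) / 2 ^ Suc n)"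

definition ends_in_ones :: "bool stream \<Rightarrow> bool" where
  "ends_in_ones u \<longleftrightarrow> (\<exists>v. u = v @- sconst True)"

text \<open>A dyadic rational in the open unit interval has two binary expansions, one ending in
  \<open>000...\<close> and one ending in \<open>111...\<close>. An element of F permutes these points and preserves their
  two sides, hence acts on expansions by preserving the kind of the expansion. The lemmas at
  the end of the theory confirm that this gives the usual prefix replacement rules on generators.\<close>

definition cantor_act :: "(real \<Rightarrow> real) \<Rightarrow> bool stream \<Rightarrow> bool stream" where
  "cantor_act f u =
     (THE u'. bin_val u' = f (bin_val u) \<and> (ends_in_ones u' \<longleftrightarrow> ends_in_ones u))"

text \<open>The library constants \<open>stabilizer\<close> and \<open>orbit\<close> are plain set definitions
  that do not depend on the order of composition.\<close>

abbreviation stabF :: "bool stream \<Rightarrow> (real \<Rightarrow> real) set" where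
  "stabF b \<equiv> stabilizer thompsonF cantor_act b"


section \<open>Schreier graphs\<close>

definition schreier_verts :: "bool stream \<Rightarrow> bool stream set" where
  "schreier_verts b = orbit thompsonF cantor_act b"

text \<open>Arrows are triples (source, label, target).\<close>

definition schreier_arrows :: "bool stream \<Rightarrow> (bool stream \<times> (real \<Rightarrow> real) \<times> bool stream) set" where
  "schreier_arrows b = {(c, s, cantor_act s c) | c s. c \<in> schreier_verts b \<and> s \<in> {x0, x1}}"

text \<open>\<open>schreier_path b c p d\<close>: the word \<open>p\<close> over the generators and their inverses is read along a
  path from \<open>c\<close> to \<open>d\<close> in the Schreier graph of \<open>b\<close>.\<close>

inductive schreier_path ::
  "bool stream \<Rightarrow> bool stream \<Rightarrow> (real \<Rightarrow> real) list \<Rightarrow> bool stream \<Rightarrow> bool" for b where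
  empty: "c \<in> schreier_verts b \<Longrightarrow> schreier_path b c [] c"
| forward: "(c, s, d) \<in> schreier_arrows b \<Longrightarrow> schreier_path b d p e \<Longrightarrow> schreier_path b c (s # p) e"
| backward: "(d, s, c) \<in> schreier_arrows b \<Longrightarrow> schreier_path b d p e \<Longrightarrow>
    schreier_path b c (inv\<^bsub>thompsonF\<^esub> s # p) e"


section \<open>The action on generators\<close>

lemma stream_eqI: "(\<And>n. s !! n = s' !! n) \<Longrightarrow> s = s'"
  using smap_alt[of id s s'] by (simp add: stream.map_id)

lemma bin_val_summable: "summable (\<lambda>n. of_bool (u !! n) / 2 ^ Suc n :: real)"
proof (rule summable_comparison_test')
  show "summable (\<lambda>n. (1/2) ^ n :: real)"
    by (rule summable_geometric) auto
  show "norm (of_bool (u !! n) / 2 ^ Suc n :: real) \<le> (1/2) ^ n" for n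
    by (auto simp: field_simps)
qed

lemma bin_val_SCons: "bin_val (c ## u) = (of_bool c + bin_val u) / 2"
proof -
  have "bin_val (c ## u) = (\<Sum>n. of_bool ((c ## u) !! Suc n) / 2 ^ Suc (Suc n)) + of_bool c / 2"
    unfolding bin_val_def using suminf_split_head[OF bin_val_summable[of "c ## u"]] by simp
  also have "(\<Sum>n. of_bool ((c ## u) !! Suc n) / 2 ^ Suc (Suc n)) = (1/2) * bin_val u"
    unfolding bin_val_def
    by (subst suminf_mult[OF bin_val_summable, symmetric]) simp
  finally show ?thesis by simp
qed

lemma bin_val_ge_0: "0 \<le> bin_val u"
  unfolding bin_val_def by (rule suminf_nonneg[OF bin_val_summable]) simp

lemma bin_val_le_1: "bin_val u \<le> 1"
proof -
  have *: "(\<lambda>n. (1/2) ^ Suc n :: real) sums 1"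
    by (rule power_half_series)
  have "bin_val u \<le> (\<Sum>n. (1/2) ^ Suc n)"
    unfolding bin_val_def
    by (rule suminf_le[OF _ bin_val_summable sums_summable[OF *]]) (auto simp: field_simps)
  then show ?thesis using sums_unique[OF *] by simp
qed

lemma bin_val_eq_1_nth: "bin_val u = 1 \<Longrightarrow> u !! n"
proof (induction n arbitrary: u)
  case 0
  then show ?case
    using bin_val_SCons[of "shd u" "stl u", unfolded stream.collapse] bin_val_le_1[of "stl u"] by (cases "shd u") auto
next
  case (Suc n)
  have "bin_val (stl u) = 1"
    using Suc.prems bin_val_SCons[of "shd u" "stl u", unfolded stream.collapse] bin_val_le_1[of "stl u"] 
    by (cases "shd u") auto
  then show ?case using Suc.IH by simp
qed

lemma bin_val_eq_0_nth: "bin_val u = 0 \<Longrightarrow> \<not> u !! n"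
proof (induction n arbitrary: u)
  case 0
  then show ?case
    using bin_val_SCons[of "shd u" "stl u", unfolded stream.collapse] bin_val_ge_0[of "stl u"] by auto
next
  case (Suc n)
  have "bin_val (stl u) = 0"
    using Suc.prems bin_val_SCons[of "shd u" "stl u", unfolded stream.collapse] bin_val_ge_0[of "stl u"]
    by (cases u; cases "shd u") auto
  then show ?case using Suc.IH by simp
qed

lemma ends_in_ones_iff: "ends_in_ones u \<longleftrightarrow> (\<exists>n. \<forall>k\<ge>n. u !! k)"
proof
  assume "ends_in_ones u"
  then obtain v where v: "u = v @- sconst True" by (auto simp: ends_in_ones_def)
  have "\<forall>k\<ge>length v. u !! k"
    by (simp add: v shift_snth_ge)
  then show "\<exists>n. \<forall>k\<ge>n. u !! k" by blast
next
  assume "\<exists>n. \<forall>k\<ge>n. u !! k"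
  then obtain n where n: "\<forall>k\<ge>n. u !! k" by blast
  have "sdrop n u = sconst True"
    by (rule stream_eqI) (use n in \<open>auto simp: sdrop_snth\<close>)
  then show "ends_in_ones u"
    unfolding ends_in_ones_def by (metis stake_sdrop)
qed

lemma ends_in_ones_SCons: "ends_in_ones (c ## u) \<longleftrightarrow> ends_in_ones u"
proof -
  have "(\<exists>n. \<forall>k\<ge>n. (c ## u) !! k) \<longleftrightarrow> (\<exists>n. \<forall>k\<ge>n. u !! k)"
    by (metis Suc_le_D Suc_le_mono le_SucI snth.simps(2) stream.sel(2))
  then show ?thesis by (simp add: ends_in_ones_iff)
qed

lemma bin_val_inj_nth:
  assumes "bin_val u = bin_val u'" "ends_in_ones u \<longleftrightarrow> ends_in_ones u'"
  shows "u !! n = u' !! n"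
  using assms
proof (induction n arbitrary: u u')
  case (0 u u')
  have *: False if eq: "bin_val (False ## s) = bin_val (True ## s')"
    and ends: "ends_in_ones s \<longleftrightarrow> ends_in_ones s'" for s s'
  proof -
    have "bin_val s = 1" "bin_val s' = 0"
      using eq bin_val_le_1[of s] bin_val_ge_0[of s'] by (auto simp: bin_val_SCons)
    then have "ends_in_ones s" "\<not> ends_in_ones s'"
      using bin_val_eq_1_nth bin_val_eq_0_nth by (auto simp: ends_in_ones_iff)
    then show False using ends by simp
  qed
  show ?case
    using 0 *[of "stl u" "stl u'"] *[of "stl u'" "stl u"]
    by (cases u; cases u'; cases "shd u"; cases "shd u'") (auto simp: ends_in_ones_SCons)
next
  case (Suc n u u')
  obtain c s c' s' where u: "u = c ## s" "u' = c' ## s'" by (metis stream.exhaust)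
  have cc: "c = c'"
  proof (rule ccontr)
    assume "c \<noteq> c'"
    then have "(bin_val s = 1 \<and> bin_val s' = 0) \<or> (bin_val s = 0 \<and> bin_val s' = 1)"
      using Suc.prems(1) bin_val_le_1[of s] bin_val_ge_0[of s'] bin_val_le_1[of s'] bin_val_ge_0[of s]
      by (cases c; cases c') (auto simp: u bin_val_SCons)
    then show False
      using Suc.prems(2) bin_val_eq_1_nth bin_val_eq_0_nth
      by (auto simp: u ends_in_ones_SCons) (metis ends_in_ones_iff order_refl)+
  qed
  have "s !! n = s' !! n"
    by (rule Suc.IH) (use Suc.prems cc in \<open>auto simp: u bin_val_SCons ends_in_ones_SCons\<close>)
  then show ?case by (simp add: u)
qed

lemma cantor_act_eqI:
  assumes "bin_val u' = f (bin_val u)" "ends_in_ones u' \<longleftrightarrow> ends_in_ones u"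
  shows "cantor_act f u = u'"
  unfolding cantor_act_def
proof (rule the_equality)
  show "bin_val u' = f (bin_val u) \<and> (ends_in_ones u' \<longleftrightarrow> ends_in_ones u)"
    using assms by simp
  show "u'' = u'" if "bin_val u'' = f (bin_val u) \<and> (ends_in_ones u'' \<longleftrightarrow> ends_in_ones u)" for u''
    by (intro stream_eqI bin_val_inj_nth) (use that assms in auto)
qed

lemma cantor_act_x0:
  "cantor_act x0 (False ## u) = False ## False ## u"
  "cantor_act x0 (True ## False ## u) = False ## True ## u"
  "cantor_act x0 (True ## True ## u) = True ## u"
  using bin_val_ge_0[of u] bin_val_le_1[of u]
  by (intro cantor_act_eqI; auto simp: ends_in_ones_SCons bin_val_SCons x0_def field_simps)+

lemma cantor_act_x1:
  "cantor_act x1 (False ## u) = False ## u"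
  "cantor_act x1 (True ## False ## u) = True ## False ## False ## u"
  "cantor_act x1 (True ## True ## False ## u) = True ## False ## True ## u"
  "cantor_act x1 (True ## True ## True ## u) = True ## True ## u"
  using bin_val_ge_0[of u] bin_val_le_1[of u]
  by (intro cantor_act_eqI; auto simp: ends_in_ones_SCons bin_val_SCons x1_def field_simps)+

end

theory Submission
  imports Defs
begin

text \<open>The proof looks at an element of F through the Cantor set, where it replaces prefixes: every
  sufficiently long word \<open>p\<close> is replaced by some word \<open>q\<close>, that is, \<open>pu\<close> is sent to \<open>qu\<close> for all \<open>u\<close>.

  Let \<open>f\<close> fix \<open>a = 10www...\<close>. A long prefix \<open>10w^k\<close> of \<open>a\<close> is replaced by a word \<open>q\<close>
  with \<open>a = qwww...\<close>, and since \<open>w\<close> is primitive its only periods are the multiples of its length,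
  so \<open>q = 10w^l\<close> (\<open>stabilizer_germ\<close>). The element \<open>g = w(x1^-1, x1^-1 x0)\<close> replaces \<open>10w\<close> by \<open>10\<close>,
  because \<open>x1^-1\<close> erases a letter 0 behind the prefix 10 and \<open>x1^-1 x0\<close> erases a letter 1.
  Hence \<open>g^-k f g^l\<close> replaces 10 by 10. So it remains to see that the elements which fix the
  cylinder of 10 pointwise are generated by \<open>x2, x3, y1, y2\<close>
  (\<open>generated_if_fixes_cylinder_10\<close>).

  Such an element is a product of one that lives on the cylinder of 0 and one that lives on
  the cylinder of 11. On the cylinder of 11, \<open>x2\<close> and \<open>x3\<close> act as \<open>x0\<close> and \<open>x1\<close>; on the cylinder
  of 0, \<open>y1\<close> acts as \<open>x0^-1\<close> and \<open>y2\<close> as \<open>y1\<close>, and \<open>x1 = x0^2 y1 x0^-1\<close>. The claim thus reduces to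
  the fact that \<open>x0\<close> and \<open>x1\<close> generate F. In the form used here it says: any two finite binary
  trees with the same number of leaves are carried to each other, leaf by leaf, by a
  product of \<open>x0\<close>, \<open>x1\<close> and inverses (\<open>gen01_equiv_same_size\<close>). Every tree can be turned
  into a right vine of the same size, working in the subtrees with copies of the
  generated group and rotating with \<open>x0\<close>; and every element of F that preserves a cylinder is
  described there by a pair of trees (\<open>fixed_cylinder_tree_pair\<close>).

  For an arbitrary rational point, the generators remove letters one at a time from a
  non-constant prefix until 10 is left (\<open>nonconstant_word_to_10\<close>). This gives a path in the
  Schreier graph that ends in a point as above, and stabilizers along it are conjugate.

  The link between the analytic definition of F and prefix replacement is Darboux's
  theorem: a derivative with values in the powers of 2 is constant between break points.\<close>

section \<open>Affine pieces of a dyadic homeomorphism\<close>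

text \<open>Darboux: the minimum of \<open>f t - c t\<close> on the interval is attained in the interior, since the
  difference decreases to the right of \<open>a\<close> and increases to the left of \<open>b\<close>.\<close>
lemma derivative_intermediate_value:
  fixes f f' :: "real \<Rightarrow> real"
  assumes "a < b" and der: "\<And>t. t \<in> {a..b} \<Longrightarrow> (f has_real_derivative f' t) (at t)"
    and c: "f' a < c" "c < f' b"
  shows "\<exists>t\<in>{a..b}. f' t = c"
proof -
  define g where "g t = f t - c * t" for t
  have g': "(g has_real_derivative (f' t - c)) (at t)" if "t \<in> {a..b}" for t
    unfolding g_def by (rule derivative_eq_intros der that refl | simp)+
  have "continuous_on {a..b} g"
    using g' by (meson DERIV_continuous continuous_at_imp_continuous_on)
  then obtain t where t: "t \<in> {a..b}" and tmin: "\<And>s. s \<in> {a..b} \<Longrightarrow> g t \<le> g s"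
    using continuous_attains_inf[of "{a..b}" g] \<open>a < b\<close> by auto
  have "t \<noteq> a"
  proof
    assume "t = a"
    obtain d where "d > 0" and d: "\<And>h. 0 < h \<Longrightarrow> h < d \<Longrightarrow> g a > g (a + h)"
      using DERIV_neg_dec_right[OF g'[of a]] c \<open>a < b\<close> by auto
    show False
      using d[of "min (d/2) (b - a)"] tmin[of "a + min (d/2) (b - a)"] \<open>d > 0\<close> \<open>a < b\<close> \<open>t = a\<close>
      by force
  qed
  moreover have "t \<noteq> b"
  proof
    assume "t = b"
    obtain d where "d > 0" and d: "\<And>h. 0 < h \<Longrightarrow> h < d \<Longrightarrow> g (b - h) < g b"
      using DERIV_pos_inc_left[OF g'[of b]] c \<open>a < b\<close> by auto
    show False
      using d[of "min (d/2) (b - a)"] tmin[of "b - min (d/2) (b - a)"] \<open>d > 0\<close> \<open>a < b\<close> \<open>t = b\<close>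
      by force
  qed
  ultimately have ab: "a < t" "t < b" using t by auto
  have "f' t - c = 0"
  proof (rule DERIV_local_min[OF g'[OF t]])
    show "0 < min (t - a) (b - t)" using ab by simp
    show "\<forall>y. \<bar>t - y\<bar> < min (t - a) (b - t) \<longrightarrow> g t \<le> g y"
      using tmin by (auto simp: abs_less_iff)
  qed
  then show ?thesis using t by auto
qed

text \<open>Two different values of the derivative would force all values in between, but
  \<open>3/2 * 2^k\<close> lies strictly between consecutive powers of 2.\<close>
lemma derivative_power_of_2_constant:
  fixes f :: "real \<Rightarrow> real"
  assumes "a < b" and der: "\<And>t. t \<in> {a<..<b} \<Longrightarrow> \<exists>k::int. (f has_real_derivative 2 powi k) (at t)"
  shows "\<exists>k::int. \<forall>t\<in>{a<..<b}. (f has_real_derivative 2 powi k) (at t)"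
proof -
  obtain e :: "real \<Rightarrow> int"
    where e: "\<And>t. t \<in> {a<..<b} \<Longrightarrow> (f has_real_derivative 2 powi (e t)) (at t)"
    using der by metis
  have gap: "(2::real) powi j \<noteq> 3/2 * 2 powi k" for j k :: int
  proof (cases "j \<le> k")
    case True
    then have "(2::real) powi j \<le> 2 powi k" by (intro power_int_increasing) auto
    then show ?thesis using zero_less_power_int[of "2::real" k] by linarith
  next
    case False
    then have "(2::real) powi (k + 1) \<le> 2 powi j" by (intro power_int_increasing) auto
    then have "2 * (2::real) powi k \<le> 2 powi j" by (simp add: power_int_add)
    then show ?thesis using zero_less_power_int[of "2::real" k] by linarith
  qed
  have gap2: "(2::real) powi k < 3/2 * 2 powi k \<and> 3/2 * (2::real) powi k < 2 powi l" if "k < l" for k l :: int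
  proof -
    have "(2::real) powi (k + 1) \<le> 2 powi l" using that by (intro power_int_increasing) auto
    then have "2 * (2::real) powi k \<le> 2 powi l" by (simp add: power_int_add)
    then show ?thesis using zero_less_power_int[of "2::real" k] by linarith
  qed
  have eq: "e s = e t" if st: "s \<in> {a<..<b}" "t \<in> {a<..<b}" "s < t" for s t
  proof (rule ccontr)
    have sub: "r \<in> {a<..<b}" if "r \<in> {s..t}" for r using that st by auto
    assume "e s \<noteq> e t"
    then consider "e s < e t" | "e t < e s" by linarith
    then show False
    proof cases
      case 1
      have "\<exists>r\<in>{s..t}. (2::real) powi e r = 3/2 * 2 powi e s"
        by (rule derivative_intermediate_value[where f = f, OF \<open>s < t\<close>])
          (use e sub gap2[OF 1] in auto)
      then show False using gap by auto
    next
      case 2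
      have "\<exists>r\<in>{s..t}. - ((2::real) powi e r) = - (3/2 * 2 powi e t)"
        by (rule derivative_intermediate_value[where f = "\<lambda>t. - f t", OF \<open>s < t\<close>])
          (use e sub gap2[OF 2] in \<open>auto intro!: DERIV_minus\<close>)
      then show False using gap by auto
    qed
  qed
  define r where "r = (a + b) / 2"
  have r: "r \<in> {a<..<b}" using \<open>a < b\<close> by (auto simp: r_def)
  have "e t = e r" if "t \<in> {a<..<b}" for t
    using eq[OF that r] eq[OF r that] by (metis linorder_neqE)
  then show ?thesis using e by metis
qed

text \<open>The description of the elements of F that is convenient for composing and inverting; \<open>thompson_carrier_iff\<close> shows
  that it is equivalent to the original one.\<close>
definition dyadic_homeo :: "(real \<Rightarrow> real) \<Rightarrow> bool" where
  "dyadic_homeo f \<longleftrightarrow>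
     (\<forall>t. t \<notin> {0..1} \<longrightarrow> f t = t) \<and> continuous_on {0..1} f \<and> strict_mono_on {0..1} f \<and>
     f 0 = 0 \<and> f 1 = 1 \<and>
     (\<exists>D. finite D \<and> D \<subseteq> dyadics \<and>
       (\<forall>t\<in>{0<..<1} - D. \<exists>k::int. (f has_real_derivative 2 powi k) (at t)))"

lemma dyadics_common_denominator:
  assumes "finite D" "D \<subseteq> (dyadics :: real set)"
  shows "\<exists>m. \<forall>d\<in>D. \<exists>i::nat. d = i / 2 ^ m"
  using assms
proof (induction rule: finite_induct)
  case (insert x D)
  then obtain m where m: "\<forall>d\<in>D. \<exists>i::nat. d = i / 2 ^ m" by auto
  obtain j k :: nat where x: "x = j / 2 ^ k"
    using insert.prems by (auto simp: dyadics_def)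
  have "\<exists>i::nat. d = i / 2 ^ (m + k)" if "d \<in> insert x D" for d
  proof (cases "d = x")
    case True
    then show ?thesis
      by (intro exI[of _ "j * 2 ^ m"]) (simp add: x power_add)
  next
    case False
    then have "d \<in> D" using that by simp
    with m have "\<exists>i::nat. d = i / 2 ^ m" by (rule bspec)
    then obtain i :: nat where "d = i / 2 ^ m" by (rule exE)
    then show ?thesis
      by (intro exI[of _ "i * 2 ^ k"]) (simp add: power_add)
  qed
  then show ?case by blast
qed auto

text \<open>For a large \<open>m\<close> all break points lie on the grid of mesh \<open>2^-m\<close>, so the derivative is a constant power of 2
  inside each grid interval.\<close>
lemma dyadic_homeo_affine:
  assumes "dyadic_homeo f"
  obtains m where "\<And>i. i < (2::nat) ^ m \<Longrightarrow>
    \<exists>k::int. \<forall>s\<in>{0..1}. f ((real i + s) / 2 ^ m) = f (i / 2 ^ m) + 2 powi k * s"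
proof -
  obtain D where D: "finite D" "D \<subseteq> dyadics"
    and der: "\<And>t. t \<in> {0<..<1} - D \<Longrightarrow> \<exists>k::int. (f has_real_derivative 2 powi k) (at t)"
    using assms by (auto simp: dyadic_homeo_def)
  have cont: "continuous_on {0..1} f" using assms by (auto simp: dyadic_homeo_def)
  obtain m where m: "\<And>d. d \<in> D \<Longrightarrow> \<exists>i::nat. d = i / 2 ^ m"
    using dyadics_common_denominator[OF D] by auto
  show thesis
  proof (rule that)
    fix i :: nat assume i: "i < 2 ^ m"
    define a b :: real where "a = i / 2 ^ m" and "b = (i + 1) / 2 ^ m"
    have "real (i + 1) \<le> 2 ^ m"
      using i by (metis Suc_eq_plus1 Suc_leI of_nat_le_iff of_nat_numeral of_nat_power)
    then have ab: "0 \<le> a" "a < b" "b \<le> 1"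
      by (auto simp: a_def b_def divide_simps)
    have "t \<in> {0<..<1} - D" if t: "t \<in> {a<..<b}" for t
    proof -
      have "t \<notin> D"
      proof
        assume "t \<in> D"
        then obtain j :: nat where j: "t = j / 2 ^ m" using m by blast
        with t have "real i < j" "real j < i + 1" by (auto simp: a_def b_def divide_simps split: if_splits)
        then show False unfolding of_nat_less_iff by simp
      qed
      then show ?thesis using t ab by auto
    qed
    then obtain k :: int where k: "\<And>t. t \<in> {a<..<b} \<Longrightarrow> (f has_real_derivative 2 powi k) (at t)"
      using derivative_power_of_2_constant[OF \<open>a < b\<close>, of f] der by blast
    define h where "h t = f t - 2 powi k * t" for t
    have hconst: "h t = h a" if "a \<le> t" "t \<le> b" for t
    proof (rule DERIV_isconst2[OF \<open>a < b\<close>])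
      show "continuous_on {a..b} h"
        unfolding h_def using ab
        by (intro continuous_intros continuous_on_subset[OF cont]) auto
      show "(h has_real_derivative 0) (at t)" if "a < t" "t < b" for t
        unfolding h_def using that
        by (auto intro!: derivative_eq_intros k)
    qed (use that in auto)
    have pm: "(2::real) ^ m > 0" by simp
    have "f ((real i + s) / 2 ^ m) = f (real i / 2 ^ m) + 2 powi (k - int m) * s" if s: "s \<in> {0..1}" for s
    proof -
      have "h ((real i + s) / 2 ^ m) = h a"
        by (rule hconst) (use s pm in \<open>auto simp: a_def b_def divide_right_mono\<close>)
      then show ?thesis
        by (simp add: h_def a_def power_int_diff field_simps)
    qed
    then show "\<exists>k::int. \<forall>s\<in>{0..1}. f ((real i + s) / 2 ^ m) = f (i / 2 ^ m) + 2 powi k * s"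
      by blast
  qed
qed

lemma dyadic_homeo_values:
  assumes f: "dyadic_homeo f" and t: "t \<in> {0..1}"
  shows "f t \<in> {0..1}"
proof -
  have "strict_mono_on {0..1} f" "f 0 = 0" "f 1 = 1" using f by (auto simp: dyadic_homeo_def)
  then show ?thesis
    using t strict_mono_on_leD[of "{0..1}" f 0 t] strict_mono_on_leD[of "{0..1}" f t 1] by auto
qed

lemma dyadics_add: "x \<in> dyadics \<Longrightarrow> y \<in> dyadics \<Longrightarrow> x + y \<in> (dyadics :: real set)"
proof -
  assume "x \<in> dyadics" "y \<in> dyadics"
  then obtain i j k l :: nat where "x = i / 2 ^ k" "y = j / 2 ^ l" by (auto simp: dyadics_def)
  then have "x + y = real (i * 2 ^ l + j * 2 ^ k) / 2 ^ (k + l)"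
    by (simp add: power_add add_frac_eq)
  then show ?thesis unfolding dyadics_def by blast
qed

lemma dyadics_powi_mult: "x \<in> dyadics \<Longrightarrow> 2 powi k * x \<in> (dyadics :: real set)" for k :: int
proof -
  assume "x \<in> dyadics"
  then obtain i l :: nat where x: "x = i / 2 ^ l" by (auto simp: dyadics_def)
  show ?thesis
  proof (cases "k \<ge> 0")
    case True
    then have "2 powi k * x = real (2 ^ nat k * i) / 2 ^ l"
      by (simp add: x power_int_def)
    then show ?thesis unfolding dyadics_def by blast
  next
    case False
    then have "2 powi k * x = real i / 2 ^ (nat (- k) + l)"
      by (simp add: x power_int_def power_add power_inverse field_simps)
    then show ?thesis unfolding dyadics_def by blast
  qed
qed

text \<open>Each step along the grid adds a power of 2 to the value.\<close>
lemma dyadic_homeo_dyadic_grid: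
  assumes f: "dyadic_homeo f"
    and aff: "\<And>i. i < (2::nat) ^ m \<Longrightarrow>
      \<exists>k::int. \<forall>s\<in>{0..1}. f ((real i + s) / 2 ^ m) = f (i / 2 ^ m) + 2 powi k * s"
    and "i \<le> 2 ^ m"
  shows "f (real i / 2 ^ m) \<in> dyadics"
  using \<open>i \<le> 2 ^ m\<close>
proof (induction i)
  case 0
  have "f 0 = 0" using f by (simp add: dyadic_homeo_def)
  then show ?case using real_in_dyadics[of 0] by simp
next
  case (Suc i)
  obtain k :: int where k: "\<forall>s\<in>{0..1}. f ((real i + s) / 2 ^ m) = f (real i / 2 ^ m) + 2 powi k * s"
    using aff[OF Suc_le_lessD[OF Suc.prems]] by blast
  have "f ((real i + 1) / 2 ^ m) = f (real i / 2 ^ m) + 2 powi k * 1"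
    by (rule bspec[OF k]) simp
  then show ?case
    using dyadics_add[OF Suc.IH dyadics_powi_mult[of 1 k]] Suc.prems real_in_dyadics[of 1]
    by (simp add: add.commute)
qed

text \<open>A dyadic homeomorphism maps every interval of a fine enough grid onto a grid interval, possibly of
  another grid. On the piece of index \<open>i0\<close> of a coarse grid the slope is a power of 2 and the initial value is \<open>a/2^e\<close>;
  once the image intervals are no longer than \<open>2^-e\<close>, their end points are multiples of their length.
  In terms of binary expansions this is the replacement of one prefix by another.\<close>
lemma dyadic_homeo_refine:
  assumes f: "dyadic_homeo f"
  obtains M where "\<And>n i. n \<ge> M \<Longrightarrow> i < (2::nat) ^ n \<Longrightarrow>
    \<exists>l j. j < (2::nat) ^ l \<and> (\<forall>s\<in>{0..1}. f ((real i + s) / 2 ^ n) = (real j + s) / 2 ^ l)"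
proof -
  obtain m where aff: "\<And>i. i < (2::nat) ^ m \<Longrightarrow>
      \<exists>k::int. \<forall>s\<in>{0..1}. f ((real i + s) / 2 ^ m) = f (i / 2 ^ m) + 2 powi k * s"
    using dyadic_homeo_affine[OF f] by blast
  then obtain k :: "nat \<Rightarrow> int" where k: "\<And>i s. i < (2::nat) ^ m \<Longrightarrow> s \<in> {0..1} \<Longrightarrow>
      f ((real i + s) / 2 ^ m) = f (real i / 2 ^ m) + 2 powi k i * s"
    by metis
  have "finite ((\<lambda>i. f (real i / 2 ^ m)) ` {..2 ^ m})" "((\<lambda>i. f (real i / 2 ^ m)) ` {..2 ^ m}) \<subseteq> dyadics"
    using dyadic_homeo_dyadic_grid[OF f aff] by (simp, blast)
  then obtain e where "\<forall>d\<in>(\<lambda>i. f (real i / 2 ^ m)) ` {..2 ^ m}. \<exists>a::nat. d = a / 2 ^ e"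
    using dyadics_common_denominator by blast
  then have e: "\<exists>a::nat. f (real i / 2 ^ m) = a / 2 ^ e" if "i \<le> 2 ^ m" for i
    using that by (metis atMost_iff imageI)
  \<comment> \<open>a common bound of the finitely many exponents\<close>
  define K where "K = (\<Sum>i<2^m. nat \<bar>k i\<bar>)"
  have K: "k i \<le> int K" if "i < 2 ^ m" for i
  proof -
    have "nat \<bar>k i\<bar> \<le> K" unfolding K_def by (rule member_le_sum) (use that in auto)
    then show ?thesis by linarith
  qed
  show thesis
  proof (rule that[of "m + e + K"])
    fix n i :: nat assume n: "n \<ge> m + e + K" and i: "i < 2 ^ n"
    define d where "d = n - m"
    have nd: "n = m + d" and d: "d \<ge> e + K" using n by (auto simp: d_def)
    define i0 r where "i0 = i div 2 ^ d" and "r = i mod 2 ^ d"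
    have i_eq: "i = i0 * 2 ^ d + r" unfolding i0_def r_def by (rule div_mult_mod_eq[symmetric])
    have r: "r < 2 ^ d" by (simp add: r_def)
    have i0: "i0 < 2 ^ m"
      using i unfolding i0_def nd by (simp add: less_mult_imp_div_less power_add)
    obtain a :: nat where a: "f (real i0 / 2 ^ m) = a / 2 ^ e" using e[of i0] i0 by auto
    \<comment> \<open>the images of the subintervals have length \<open>2^-l\<close>, and \<open>l \<ge> e\<close>\<close>
    define l where "l = nat (int d - k i0)"
    have l: "int l = int d - k i0" and le: "l \<ge> e" using K[OF i0] d by (auto simp: l_def)
    define j where "j = a * 2 ^ (l - e) + r"
    have eq: "f ((real i + s) / 2 ^ n) = (real j + s) / 2 ^ l" if s: "s \<in> {0..1}" for s
    proof -
      have s': "(real r + s) / 2 ^ d \<in> {0..1}"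
      proof -
        have "real (r + 1) \<le> 2 ^ d" using r by (metis Suc_eq_plus1 Suc_leI of_nat_le_iff of_nat_numeral of_nat_power)
        then show ?thesis using s by (auto simp: divide_simps)
      qed
      have "(real i + s) / 2 ^ n = (real i0 + (real r + s) / 2 ^ d) / 2 ^ m"
        by (simp add: i_eq nd power_add field_simps)
      then have "f ((real i + s) / 2 ^ n) = a / 2 ^ e + 2 powi k i0 * ((real r + s) / 2 ^ d)"
        using k[OF i0 s'] a by simp
      also have "2 powi k i0 = (2::real) ^ d / 2 ^ l"
      proof -
        have "(2::real) powi k i0 = 2 powi (int d - int l)" using l by simp
        also have "\<dots> = 2 ^ d / 2 ^ l" by (simp add: power_int_diff)
        finally show ?thesis .
      qed
      also have "a / 2 ^ e + (2::real) ^ d / 2 ^ l * ((real r + s) / 2 ^ d) = (real j + s) / 2 ^ l"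
      proof -
        have "(2::real) ^ l = 2 ^ e * 2 ^ (l - e)" using le by (simp add: power_add[symmetric])
        then show ?thesis by (simp add: j_def field_simps)
      qed
      finally show ?thesis .
    qed
    have "(j + 1) / 2 ^ l \<le> (1::real)"
    proof -
      have "real (i + 1) \<le> 2 ^ n" using i by (metis Suc_eq_plus1 Suc_leI of_nat_le_iff of_nat_numeral of_nat_power)
      then have "(i + 1) / 2 ^ n \<in> {0..1::real}" by (auto simp: divide_simps)
      from dyadic_homeo_values[OF f this] eq[of 1] show ?thesis by (simp add: add.commute)
    qed
    then have "real (j + 1) \<le> real (2 ^ l)" by (simp add: divide_simps)
    then have "j < 2 ^ l" unfolding of_nat_le_iff by simp
    with eq show "\<exists>l j. j < (2::nat) ^ l \<and> (\<forall>s\<in>{0..1}. f ((real i + s) / 2 ^ n) = (real j + s) / 2 ^ l)"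
      by blast
  qed
qed

section \<open>Thompson's group F is a group\<close>

lemma dyadic_homeo_surj:
  assumes "dyadic_homeo f"
  shows "f ` {0..1} = {0..1}"
proof
  show "f ` {0..1} \<subseteq> {0..1}" using dyadic_homeo_values[OF assms] by blast
  show "{0..1} \<subseteq> f ` {0..1}"
  proof
    fix y :: real assume y: "y \<in> {0..1}"
    have "\<exists>x\<ge>0. x \<le> 1 \<and> f x = y"
      by (rule IVT') (use y assms in \<open>auto simp: dyadic_homeo_def\<close>)
    then show "y \<in> f ` {0..1}" by auto
  qed
qed

lemma dyadic_homeo_piecewise_linear:
  assumes f: "dyadic_homeo f"
  shows "piecewise_linear01 f"
proof -
  obtain m where aff: "\<And>i. i < (2::nat) ^ m \<Longrightarrow>
      \<exists>k::int. \<forall>s\<in>{0..1}. f ((real i + s) / 2 ^ m) = f (real i / 2 ^ m) + 2 powi k * s"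
    using dyadic_homeo_affine[OF f] by blast
  define B where "B = (\<lambda>i::nat. real i / 2 ^ m) ` {..2 ^ m}"
  have "\<exists>\<mu> c. \<forall>t\<in>{p<..<q}. f t = \<mu> * t + c" if pq: "p < q" "{p<..<q} \<subseteq> {0..1} - B" for p q
  proof -
    define c where "c = (p + q) / 2"
    have c: "p < c" "c < q" using pq by (auto simp: c_def)
    have "(c + q) / 2 \<in> {p<..<q}" using c by auto
    from subsetD[OF pq(2) this] have "(c + q) / 2 \<le> 1" by auto
    then have "c < 1" using c by auto
    have "c \<ge> 0" using pq c by auto
    define i where "i = nat \<lfloor>c * 2 ^ m\<rfloor>"
    have i: "real i \<le> c * 2 ^ m" "c * 2 ^ m < real i + 1"
      using \<open>c \<ge> 0\<close> by (auto simp: i_def)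
    have "c * 2 ^ m < 1 * 2 ^ m" using \<open>c < 1\<close> by (intro mult_strict_right_mono) auto
    with i(1) have "real i < 2 ^ m" by linarith
    then have "real i < real (2 ^ m)" by simp
    then have i2: "i < 2 ^ m" by (simp only: of_nat_less_iff)
    have "real i / 2 ^ m \<in> B" "real (Suc i) / 2 ^ m \<in> B"
      unfolding B_def by (rule imageI, use i2 in simp)+
    then have "real i / 2 ^ m \<notin> {p<..<q}" "real (Suc i) / 2 ^ m \<notin> {p<..<q}" using pq by blast+
    moreover have "real i / 2 ^ m \<le> c" "c < real (Suc i) / 2 ^ m" using i by (simp_all add: field_simps)
    ultimately have "real i / 2 ^ m \<le> p" "q \<le> real (Suc i) / 2 ^ m"
      unfolding greaterThanLessThan_iff using c by linarith+
    then have lo: "real i / 2 ^ m \<le> p" and hi: "q \<le> (real i + 1) / 2 ^ m"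
      by (simp_all add: add.commute)
    obtain k :: int where k: "\<And>s. s \<in> {0..1} \<Longrightarrow> f ((real i + s) / 2 ^ m) = f (real i / 2 ^ m) + 2 powi k * s"
      using aff[OF i2] by blast
    have "f t = (2 powi k * 2 ^ m) * t + (f (real i / 2 ^ m) - 2 powi k * real i)" if t: "t \<in> {p<..<q}" for t
    proof -
      have "real i / 2 ^ m \<le> t" "t \<le> (real i + 1) / 2 ^ m" using t lo hi by auto
      then have "real i \<le> t * 2 ^ m" "t * 2 ^ m \<le> real i + 1" by (simp_all add: field_simps)
      then have "f ((real i + (t * 2 ^ m - real i)) / 2 ^ m) = f (real i / 2 ^ m) + 2 powi k * (t * 2 ^ m - real i)"
        by (intro k) auto
      then show ?thesis by (simp add: algebra_simps)
    qed
    then show ?thesis by blast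
  qed
  moreover have "finite B" by (simp add: B_def)
  ultimately show ?thesis unfolding piecewise_linear01_def by blast
qed

lemma dyadic_homeo_inj: "dyadic_homeo f \<Longrightarrow> inj_on f {0..1}"
  by (auto simp: dyadic_homeo_def intro: strict_mono_on_imp_inj_on)

lemma dyadic_homeo_homeomorphism:
  assumes "dyadic_homeo f"
  shows "\<exists>g. homeomorphism {0..1} {0..1} f g"
  by (rule homeomorphism_compact)
    (use assms dyadic_homeo_surj dyadic_homeo_inj in \<open>auto simp: dyadic_homeo_def\<close>)

lemma thompson_carrier_iff: "f \<in> thompson_carrier \<longleftrightarrow> dyadic_homeo f"
proof
  assume f: "f \<in> thompson_carrier"
  then obtain g where "homeomorphism {0..1} {0..1} f g" and mono: "strict_mono_on {0..1} f"
    by (auto simp: thompson_carrier_def)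
  then have cont: "continuous_on {0..1} f" and surj: "f ` {0..1} = {0..1}"
    by (auto simp: homeomorphism_def)
  have "0 \<in> f ` {0..1}" "1 \<in> f ` {0..1}" unfolding surj by auto
  then obtain s t where st: "s \<in> {0..1}" "f s = 0" "t \<in> {0..1}" "f t = 1" by auto
  have "f 0 \<in> {0..1}" "f 1 \<in> {0..1}" using surj by auto
  moreover have "f 0 \<le> f s" "f t \<le> f 1"
    using st strict_mono_on_leD[OF mono, of 0 s] strict_mono_on_leD[OF mono, of t 1] by auto
  ultimately have "f 0 = 0" "f 1 = 1" using st by auto
  then show "dyadic_homeo f"
    using f mono cont unfolding thompson_carrier_def dyadic_homeo_def by blast
next
  assume f: "dyadic_homeo f"
  then show "f \<in> thompson_carrier"
    using dyadic_homeo_homeomorphism[OF f] dyadic_homeo_piecewise_linear[OF f]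
    unfolding thompson_carrier_def dyadic_homeo_def by blast
qed

text \<open>A dyadic number is an end point of an interval of every fine enough grid, so its image is an end point
  of a grid interval. This keeps the break points of inverses and products dyadic.\<close>
lemma dyadic_homeo_dyadic:
  assumes f: "dyadic_homeo f" and d: "d \<in> dyadics" "d \<in> {0..1}"
  shows "f d \<in> dyadics"
proof (cases "d = 1")
  case True
  then show ?thesis using f real_in_dyadics[of 1] by (simp add: dyadic_homeo_def)
next
  case False
  obtain M where M: "\<And>n i. n \<ge> M \<Longrightarrow> i < (2::nat) ^ n \<Longrightarrow>
    \<exists>l j. j < (2::nat) ^ l \<and> (\<forall>s\<in>{0..1}. f ((real i + s) / 2 ^ n) = (real j + s) / 2 ^ l)"
    using dyadic_homeo_refine[OF f] by blast
  obtain a k :: nat where a: "d = a / 2 ^ k" using d by (auto simp: dyadics_def)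
  have d': "d = real (a * 2 ^ M) / 2 ^ (k + M)" by (simp add: a power_add)
  have "d < 1" using False d by auto
  then have "real (a * 2 ^ M) < real (2 ^ (k + M))" unfolding d' by (simp add: divide_simps)
  then have "a * 2 ^ M < 2 ^ (k + M)" by (simp only: of_nat_less_iff)
  then obtain l j where "\<forall>s\<in>{0..1}. f ((real (a * 2 ^ M) + s) / 2 ^ (k + M)) = (real j + s) / 2 ^ l"
    using M[of "k + M"] by (metis le_add2)
  then have "f d = real j / 2 ^ l" unfolding d' by (drule_tac bspec[of _ _ 0]) auto
  then show ?thesis by (auto simp: dyadics_def)
qed

lemma dyadic_homeo_interior:
  assumes "dyadic_homeo f" "t \<in> {0<..<1}"
  shows "f t \<in> {0<..<1}"
proof -
  have m: "strict_mono_on {0..1} f" "f 0 = 0" "f 1 = 1" using assms by (auto simp: dyadic_homeo_def)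
  have "f 0 < f t" "f t < f 1" using assms by (auto intro!: strict_mono_onD[OF m(1)])
  then show ?thesis using m by auto
qed

lemma dyadic_homeo_inverse:
  assumes f: "dyadic_homeo f"
  obtains g where "dyadic_homeo g" "\<And>t. g (f t) = t" "\<And>t. f (g t) = t"
proof -
  obtain g where "homeomorphism {0..1} {0..1} f g" using dyadic_homeo_homeomorphism[OF f] by blast
  then have g: "continuous_on {0..1} g" "\<And>t. t \<in> {0..1} \<Longrightarrow> g (f t) = t" "\<And>t. t \<in> {0..1} \<Longrightarrow> f (g t) = t"
    and gv: "\<And>t. t \<in> {0..1} \<Longrightarrow> g t \<in> {0..1}"
    by (auto simp: homeomorphism_def)
  define G where "G t = (if t \<in> {0..1} then g t else t)" for t
  have f_id: "f t = t" if "t \<notin> {0..1}" for t using f that by (auto simp: dyadic_homeo_def)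
  have mono: "strict_mono_on {0..1} f" and ends: "f 0 = 0" "f 1 = 1" using f by (auto simp: dyadic_homeo_def)
  obtain D where D: "finite D" "D \<subseteq> dyadics"
    and der: "\<And>t. t \<in> {0<..<1} - D \<Longrightarrow> \<exists>k::int. (f has_real_derivative 2 powi k) (at t)"
    using f by (auto simp: dyadic_homeo_def)
  have Gf: "G (f t) = t" for t
    using dyadic_homeo_values[OF f, of t] f_id[of t] g(2)[of t] unfolding G_def by (cases "t \<in> {0..1}") auto
  have fG: "f (G t) = t" for t
    using f_id[of t] g(3)[of t] unfolding G_def by (cases "t \<in> {0..1}") auto
  have contG: "continuous_on {0..1} G"
    using g(1) by (rule continuous_on_eq) (simp add: G_def)
  have G01: "G 0 = 0" "G 1 = 1" using Gf[of 0] Gf[of 1] ends by auto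
  have Gv: "G t \<in> {0..1}" if "t \<in> {0..1}" for t using gv[OF that] that by (auto simp: G_def)
  have monoG: "strict_mono_on {0..1} G"
  proof (rule strict_mono_onI)
    fix r s :: real assume rs: "r \<in> {0..1}" "s \<in> {0..1}" "r < s"
    show "G r < G s"
    proof (rule ccontr)
      assume "\<not> G r < G s"
      then have "f (G s) \<le> f (G r)" using rs Gv by (intro strict_mono_on_leD[OF mono]) auto
      then show False using rs fG by auto
    qed
  qed
  have "\<exists>k::int. (G has_real_derivative 2 powi k) (at t)" if t: "t \<in> {0<..<1} - f ` (D \<inter> {0..1})" for t
  proof -
    have "G 0 < G t" "G t < G 1" using t by (auto intro!: strict_mono_onD[OF monoG])
    then have "G t \<in> {0<..<1}" using G01 by auto
    moreover have "G t \<notin> D" using t fG[of t] \<open>G t \<in> {0<..<1}\<close> by (auto intro: image_eqI[of t f "G t"])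
    ultimately obtain k :: int where "(f has_real_derivative 2 powi k) (at (G t))" using der by blast
    moreover have "continuous_on {0<..<1} G" by (rule continuous_on_subset[OF contG]) auto
    then have "isCont G t" using t by (simp add: continuous_on_eq_continuous_at)
    ultimately have "(G has_real_derivative inverse (2 powi k)) (at t)"
      using t by (intro DERIV_inverse_function[where a = 0 and b = 1 and f = f]) (auto simp: fG)
    then have "(G has_real_derivative 2 powi (- k)) (at t)" by (simp add: power_int_minus)
    then show ?thesis by blast
  qed
  moreover have "finite (f ` (D \<inter> {0..1}))" using D by simp
  moreover have "f ` (D \<inter> {0..1}) \<subseteq> dyadics" using D dyadic_homeo_dyadic[OF f] by blast
  moreover have "\<forall>t. t \<notin> {0..1} \<longrightarrow> G t = t" by (auto simp: G_def)
  ultimately have "dyadic_homeo G"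
    unfolding dyadic_homeo_def using contG monoG G01 by blast
  then show thesis using Gf fG that by blast
qed

lemma dyadic_homeo_comp:
  assumes f: "dyadic_homeo f" and g: "dyadic_homeo g"
  shows "dyadic_homeo (g \<circ> f)"
proof -
  obtain h where h: "dyadic_homeo h" "\<And>t. h (f t) = t"
    using dyadic_homeo_inverse[OF f] by metis
  obtain D where D: "finite D" "D \<subseteq> dyadics"
    and der: "\<And>t. t \<in> {0<..<1} - D \<Longrightarrow> \<exists>k::int. (f has_real_derivative 2 powi k) (at t)"
    using f by (auto simp: dyadic_homeo_def)
  obtain E where E: "finite E" "E \<subseteq> dyadics"
    and der': "\<And>t. t \<in> {0<..<1} - E \<Longrightarrow> \<exists>k::int. (g has_real_derivative 2 powi k) (at t)"
    using g by (auto simp: dyadic_homeo_def)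
  have "\<exists>k::int. (g \<circ> f has_real_derivative 2 powi k) (at t)"
    if t: "t \<in> {0<..<1} - (D \<union> h ` (E \<inter> {0..1}))" for t
  proof -
    have ft: "f t \<in> {0<..<1}" using dyadic_homeo_interior[OF f] t by blast
    moreover have "f t \<notin> E" using t h(2)[of t] ft by (auto intro: image_eqI[of t h "f t"])
    ultimately obtain k :: int where k: "(g has_real_derivative 2 powi k) (at (f t))" using der' by blast
    obtain l :: int where l: "(f has_real_derivative 2 powi l) (at t)" using der t by blast
    from DERIV_chain[OF k l] have "(g \<circ> f has_real_derivative 2 powi (k + l)) (at t)"
      by (simp add: power_int_add)
    then show ?thesis by blast
  qed
  moreover have "finite (D \<union> h ` (E \<inter> {0..1}))" using D E by simp
  moreover have "D \<union> h ` (E \<inter> {0..1}) \<subseteq> dyadics" using D E dyadic_homeo_dyadic[OF h(1)] by blast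
  moreover have "continuous_on {0..1} (g \<circ> f)"
    by (rule continuous_on_compose) (use f g in \<open>auto simp: dyadic_homeo_surj dyadic_homeo_def[of g] dyadic_homeo_def[of f]\<close>)
  moreover have "strict_mono_on {0..1} (g \<circ> f)"
  proof (rule strict_mono_onI)
    fix r s :: real assume rs: "r \<in> {0..1}" "s \<in> {0..1}" "r < s"
    then have "f r < f s" using f by (auto simp: dyadic_homeo_def intro: strict_mono_onD)
    then show "(g \<circ> f) r < (g \<circ> f) s"
      using g rs dyadic_homeo_values[OF f] unfolding o_def
      by (auto simp: dyadic_homeo_def intro!: strict_mono_onD[of "{0..1}" g])
  qed
  moreover have "\<forall>t. t \<notin> {0..1} \<longrightarrow> (g \<circ> f) t = t" "(g \<circ> f) 0 = 0" "(g \<circ> f) 1 = 1"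
    using f g by (auto simp: dyadic_homeo_def)
  ultimately show ?thesis
    unfolding dyadic_homeo_def by blast
qed

lemma dyadic_homeo_id: "dyadic_homeo id"
proof -
  have "(id has_real_derivative 2 powi 0) (at t)" for t :: real
    unfolding id_def by simp
  then have "\<exists>k::int. (id has_real_derivative 2 powi k) (at t)" for t :: real by blast
  then show ?thesis
    unfolding dyadic_homeo_def by (auto intro!: strict_mono_onI exI[of _ "{}"])
qed

lemma thompsonF_simps:
  "carrier thompsonF = Collect dyadic_homeo" "f \<otimes>\<^bsub>thompsonF\<^esub> g = g \<circ> f" "\<one>\<^bsub>thompsonF\<^esub> = id"
  by (auto simp: thompsonF_def thompson_carrier_iff)

interpretation F: group thompsonF
proof (rule groupI)
  fix f assume "f \<in> carrier thompsonF"
  then have "dyadic_homeo f" by (simp add: thompsonF_simps)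
  then obtain g where "dyadic_homeo g" "\<And>t. f (g t) = t" using dyadic_homeo_inverse by metis
  then show "\<exists>g\<in>carrier thompsonF. g \<otimes>\<^bsub>thompsonF\<^esub> f = \<one>\<^bsub>thompsonF\<^esub>"
    by (auto simp: thompsonF_simps fun_eq_iff)
qed (auto simp: thompsonF_simps dyadic_homeo_comp dyadic_homeo_id o_assoc)

text \<open>For concrete functions it suffices to exhibit an affine formula around each point off the
  break points.\<close>
lemma dyadic_homeoI:
  assumes id: "\<And>t. t \<notin> {0..1} \<Longrightarrow> f t = t" and cont: "continuous_on {0..1} f"
    and ends: "f 0 = 0" "f 1 = 1" and mono: "strict_mono_on {0..1} f"
    and D: "finite D" "D \<subseteq> dyadics"
    and aff: "\<And>t. t \<in> {0<..<1} - D \<Longrightarrow> \<exists>(k::int) c a b. t \<in> {a<..<b} \<and> (\<forall>s\<in>{a<..<b}. f s = 2 powi k * s + c)"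
  shows "dyadic_homeo f"
proof -
  have "\<exists>k::int. (f has_real_derivative 2 powi k) (at t)" if t: "t \<in> {0<..<1} - D" for t
  proof -
    obtain k :: int and c a b where *: "t \<in> {a<..<b}" "\<And>s. s \<in> {a<..<b} \<Longrightarrow> f s = 2 powi k * s + c"
      using aff[OF t] by blast
    have "((\<lambda>s. 2 powi k * s + c) has_real_derivative 2 powi k) (at t)"
      by (auto intro!: derivative_eq_intros)
    then have "(f has_real_derivative 2 powi k) (at t)"
      by (rule has_field_derivative_transform_within_open[where S = "{a<..<b}"]) (use * in auto)
    then show ?thesis by blast
  qed
  then show ?thesis unfolding dyadic_homeo_def using assms by blast
qed

lemma x0_carrier [simp]: "x0 \<in> carrier thompsonF"
proof -
  have "dyadic_homeo x0"
  proof (rule dyadic_homeoI[where D = "{1/2, 3/4}"])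
    \<comment> \<open>\<open>x0\<close> has increasing slopes, so it is the maximum of its affine pieces\<close>
    have "continuous_on {0..1} (\<lambda>t::real. max (t / 2) (max (t - 1/4) (2 * t - 1)))"
      by (intro continuous_intros) auto
    then show "continuous_on {0..1} x0"
      by (rule continuous_on_eq) (auto simp: x0_def max_def)
    show "{1/2, 3/4} \<subseteq> (dyadics :: real set)"
    proof -
      have "1/2 = real 1 / 2 ^ 1" "3/4 = real 3 / 2 ^ 2" by auto
      then show ?thesis unfolding dyadics_def by blast
    qed
    fix t :: real assume t: "t \<in> {0<..<1} - {1/2, 3/4}"
    then consider "t \<in> {0<..<1/2}" | "t \<in> {1/2<..<3/4}" | "t \<in> {3/4<..<1}" by force
    then show "\<exists>(k::int) c a b. t \<in> {a<..<b} \<and> (\<forall>s\<in>{a<..<b}. x0 s = 2 powi k * s + c)"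
    proof cases
      case 1
      then show ?thesis
        by (intro exI[of _ "-1"] exI[of _ 0] exI[of _ "1/2"]) (auto simp: x0_def power_int_minus)
    next
      case 2
      then show ?thesis
        by (intro exI[of _ 0] exI[of _ "-1/4"] exI[of _ "1/2"] exI[of _ "3/4"]) (auto simp: x0_def)
    next
      case 3
      then show ?thesis
        by (intro exI[of _ 1] exI[of _ "-1"] exI[of _ "3/4"] exI[of _ "1"]) (auto simp: x0_def)
    qed
  qed (auto simp: x0_def intro!: strict_mono_onI)
  then show ?thesis by (simp add: thompsonF_simps)
qed

lemma x1_carrier [simp]: "x1 \<in> carrier thompsonF"
proof -
  have "dyadic_homeo x1"
  proof (rule dyadic_homeoI[where D = "{1/2, 3/4, 7/8}"])
    have "continuous_on {0..1} (\<lambda>t::real. max (min t (t / 2 + 1/4)) (max (t - 1/8) (2 * t - 1)))"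
      by (intro continuous_intros) auto
    then show "continuous_on {0..1} x1"
      by (rule continuous_on_eq) (auto simp: x1_def max_def min_def)
    show "{1/2, 3/4, 7/8} \<subseteq> (dyadics :: real set)"
    proof -
      have "1/2 = real 1 / 2 ^ 1" "3/4 = real 3 / 2 ^ 2" "7/8 = real 7 / 2 ^ 3" by auto
      then show ?thesis unfolding dyadics_def by blast
    qed
    fix t :: real assume t: "t \<in> {0<..<1} - {1/2, 3/4, 7/8}"
    then consider "t \<in> {0<..<1/2}" | "t \<in> {1/2<..<3/4}" | "t \<in> {3/4<..<7/8}" | "t \<in> {7/8<..<1}" by force
    then show "\<exists>(k::int) c a b. t \<in> {a<..<b} \<and> (\<forall>s\<in>{a<..<b}. x1 s = 2 powi k * s + c)"
    proof cases
      case 1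
      then show ?thesis
        by (intro exI[of _ 0] exI[of _ 0] exI[of _ "1/2"]) (auto simp: x1_def)
    next
      case 2
      then show ?thesis
        by (intro exI[of _ "-1"] exI[of _ "1/4"] exI[of _ "1/2"] exI[of _ "3/4"]) (auto simp: x1_def power_int_minus)
    next
      case 3
      then show ?thesis
        by (intro exI[of _ 0] exI[of _ "-1/8"] exI[of _ "3/4"] exI[of _ "7/8"]) (auto simp: x1_def)
    next
      case 4
      then show ?thesis
        by (intro exI[of _ 1] exI[of _ "-1"] exI[of _ "7/8"] exI[of _ "1"]) (auto simp: x1_def)
    qed
  qed (auto simp: x1_def intro!: strict_mono_onI)
  then show ?thesis by (simp add: thompsonF_simps)
qed

section \<open>Prefix replacement\<close>

lemma bin_val_sconst [simp]: "bin_val (sconst c) = of_bool c"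
proof -
  have "sconst c = c ## sconst c" by (subst siterate.code) simp
  then have "bin_val (sconst c) = bin_val (c ## sconst c)" by (rule arg_cong)
  also have "\<dots> = (of_bool c + bin_val (sconst c)) / 2" by (rule bin_val_SCons)
  finally show ?thesis by simp
qed

text \<open>The cylinder of \<open>p\<close> is an interval of the grid of mesh \<open>2^-n\<close> for \<open>n = length p\<close>; conversely, by the
  next lemma, every interval of a dyadic grid is the cylinder of a word.\<close>
lemma bin_val_shift_word:
  obtains i where "i < (2::nat) ^ length p" "\<And>u. bin_val (p @- u) = (real i + bin_val u) / 2 ^ length p"
proof (induction p arbitrary: thesis)
  case Nil
  then show ?case by (auto intro: Nil[of 0])
next
  case (Cons c p)
  obtain i where i: "i < (2::nat) ^ length p" "\<And>u. bin_val (p @- u) = (real i + bin_val u) / 2 ^ length p"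
    using Cons.IH by blast
  show ?case
  proof (rule Cons.prems)
    show "of_bool c * 2 ^ length p + i < 2 ^ length (c # p)" using i(1) by simp
    show "bin_val ((c # p) @- u) = (real (of_bool c * 2 ^ length p + i) + bin_val u) / 2 ^ length (c # p)" for u
      by (simp add: bin_val_SCons i(2) field_simps)
  qed
qed

lemma word_of_grid_index:
  assumes "i < (2::nat) ^ l"
  shows "\<exists>q. \<forall>u. bin_val (q @- u) = (real i + bin_val u) / 2 ^ l"
  using assms
proof (induction l arbitrary: i)
  case 0
  then show ?case by (intro exI[of _ "[]"]) simp
next
  case (Suc l)
  define c j where "c = (2 ^ l \<le> i)" and "j = i - of_bool c * 2 ^ l"
  have ij: "i = of_bool c * 2 ^ l + j" and "j < 2 ^ l"
    using Suc.prems by (auto simp: c_def j_def)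
  then obtain q where q: "\<forall>u. bin_val (q @- u) = (real j + bin_val u) / 2 ^ l"
    using Suc.IH by blast
  have "bin_val ((c # q) @- u) = (real i + bin_val u) / 2 ^ Suc l" for u
    by (simp add: bin_val_SCons q ij field_simps)
  then show ?case by blast
qed

text \<open>The digits of \<open>x\<close> come from iterating the doubling map. Each step halves the distance between
  \<open>x\<close> and the value of its digit sequence, so the distance is 0.\<close>
lemma bin_val_surj:
  assumes "x \<in> {0..1}"
  obtains u where "bin_val u = x"
proof -
  define step :: "real \<Rightarrow> real" where "step x = (if x \<ge> 1/2 then 2 * x - 1 else 2 * x)" for x
  define digits where "digits x = smap (\<lambda>x. x \<ge> 1/2) (siterate step x)" for x
  have digits: "digits x = (x \<ge> 1/2) ## digits (step x)" for x
    unfolding digits_def by (subst siterate.code) simp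
  have approx: "\<bar>bin_val (digits x) - x\<bar> \<le> (1/2) ^ n" if "x \<in> {0..1}" for n x
    using that
  proof (induction n arbitrary: x)
    case 0
    then show ?case using bin_val_ge_0[of "digits x"] bin_val_le_1[of "digits x"] by auto
  next
    case (Suc n)
    have "step x \<in> {0..1}" using Suc.prems by (auto simp: step_def)
    from Suc.IH[OF this] show ?case
      by (subst digits) (auto simp: bin_val_SCons step_def abs_le_iff field_simps split: if_splits)
  qed
  have "bin_val (digits x) = x"
  proof (rule ccontr)
    assume "bin_val (digits x) \<noteq> x"
    then have "0 < \<bar>bin_val (digits x) - x\<bar>" by simp
    then obtain n where "(1/2) ^ n < \<bar>bin_val (digits x) - x\<bar>"
      using real_arch_pow_inv[of "\<bar>bin_val (digits x) - x\<bar>" "1/2"] by auto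
    then show False using approx[OF assms, of n] by simp
  qed
  then show thesis by (rule that)
qed

lemma ends_in_ones_shift: "ends_in_ones (p @- u) \<longleftrightarrow> ends_in_ones u"
  by (induction p) (auto simp: ends_in_ones_SCons)

definition replaces :: "(real \<Rightarrow> real) \<Rightarrow> bool list \<Rightarrow> bool list \<Rightarrow> bool" where
  "replaces f p q \<longleftrightarrow> (\<forall>u. cantor_act f (p @- u) = q @- u)"

text \<open>The refinement lemma read on words instead of grid indices.\<close>
lemma carrier_replaces_real:
  assumes "f \<in> carrier thompsonF"
  obtains m where "\<And>p. length p \<ge> m \<Longrightarrow> \<exists>q. \<forall>u. f (bin_val (p @- u)) = bin_val (q @- u)"
proof -
  obtain M where M: "\<And>n i. n \<ge> M \<Longrightarrow> i < (2::nat) ^ n \<Longrightarrow>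
    \<exists>l j. j < (2::nat) ^ l \<and> (\<forall>s\<in>{0..1}. f ((real i + s) / 2 ^ n) = (real j + s) / 2 ^ l)"
    using dyadic_homeo_refine assms unfolding thompsonF_simps by blast
  show thesis
  proof (rule that)
    fix p :: "bool list" assume "length p \<ge> M"
    obtain i where i: "i < (2::nat) ^ length p" "\<And>u. bin_val (p @- u) = (real i + bin_val u) / 2 ^ length p"
      using bin_val_shift_word by blast
    obtain l j where lj: "j < (2::nat) ^ l" "\<forall>s\<in>{0..1}. f ((real i + s) / 2 ^ length p) = (real j + s) / 2 ^ l"
      using M[OF \<open>length p \<ge> M\<close> i(1)] by blast
    obtain q where q: "\<forall>u. bin_val (q @- u) = (real j + bin_val u) / 2 ^ l"
      using word_of_grid_index[OF lj(1)] by blast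
    have "f (bin_val (p @- u)) = bin_val (q @- u)" for u
      using bspec[OF lj(2), of "bin_val u"] bin_val_ge_0[of u] bin_val_le_1[of u] by (simp add: i(2) q)
    then show "\<exists>q. \<forall>u. f (bin_val (p @- u)) = bin_val (q @- u)" by blast
  qed
qed

lemma carrier_replaces:
  assumes "f \<in> carrier thompsonF"
  obtains m where "\<And>p. length p \<ge> m \<Longrightarrow> \<exists>q. replaces f p q"
proof -
  obtain m where m: "\<And>p. length p \<ge> m \<Longrightarrow> \<exists>q. \<forall>u. f (bin_val (p @- u)) = bin_val (q @- u)"
    using carrier_replaces_real[OF assms] by blast
  show thesis
  proof (rule that)
    fix p :: "bool list" assume "length p \<ge> m"
    then obtain q where "\<forall>u. f (bin_val (p @- u)) = bin_val (q @- u)" using m by blast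
    then show "\<exists>q. replaces f p q"
      unfolding replaces_def by (intro exI[of _ q] allI cantor_act_eqI) (auto simp: ends_in_ones_shift)
  qed
qed

text \<open>Since \<open>f\<close> replaces a prefix of \<open>u\<close>, there is an expansion of \<open>f (bin_val u)\<close> with the same tail as \<open>u\<close>.
  This shows that the definite description in \<open>cantor_act\<close> denotes.\<close>
lemma cantor_act_spec:
  assumes "f \<in> carrier thompsonF"
  shows "bin_val (cantor_act f u) = f (bin_val u)" "ends_in_ones (cantor_act f u) \<longleftrightarrow> ends_in_ones u"
proof -
  obtain m where m: "\<And>p. length p \<ge> m \<Longrightarrow> \<exists>q. \<forall>u. f (bin_val (p @- u)) = bin_val (q @- u)"
    using carrier_replaces_real[OF assms] by blast
  obtain q where q: "\<And>v. f (bin_val (stake m u @- v)) = bin_val (q @- v)"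
    using m[of "stake m u"] by auto
  have ends: "ends_in_ones (sdrop m u) \<longleftrightarrow> ends_in_ones u"
    using ends_in_ones_shift[of "stake m u" "sdrop m u"] by (simp add: stake_sdrop)
  have "cantor_act f u = q @- sdrop m u"
    by (rule cantor_act_eqI) (use q[of "sdrop m u"] in \<open>auto simp: stake_sdrop ends_in_ones_shift ends\<close>)
  then show "bin_val (cantor_act f u) = f (bin_val u)" "ends_in_ones (cantor_act f u) \<longleftrightarrow> ends_in_ones u"
    using q[of "sdrop m u"] by (auto simp: stake_sdrop ends_in_ones_shift ends)
qed

lemma cantor_act_mult:
  assumes "f \<in> carrier thompsonF" "g \<in> carrier thompsonF"
  shows "cantor_act (f \<otimes>\<^bsub>thompsonF\<^esub> g) u = cantor_act g (cantor_act f u)"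
  by (rule cantor_act_eqI) (use assms in \<open>auto simp: cantor_act_spec thompsonF_simps(2)\<close>)

lemma cantor_act_one [simp]: "cantor_act \<one>\<^bsub>thompsonF\<^esub> u = u"
  by (rule cantor_act_eqI) (auto simp: thompsonF_simps)

lemma cantor_act_inv:
  assumes "f \<in> carrier thompsonF"
  shows "cantor_act (inv\<^bsub>thompsonF\<^esub> f) (cantor_act f u) = u" "cantor_act f (cantor_act (inv\<^bsub>thompsonF\<^esub> f) u) = u"
  using assms by (simp_all flip: cantor_act_mult)

lemma cantor_act_inv_eqI:
  "f \<in> carrier thompsonF \<Longrightarrow> cantor_act f u = v \<Longrightarrow> cantor_act (inv\<^bsub>thompsonF\<^esub> f) v = u"
  using cantor_act_inv by blast

text \<open>Every point of the interval has a binary expansion.\<close>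
lemma cantor_act_faithful:
  assumes f: "f \<in> carrier thompsonF" and g: "g \<in> carrier thompsonF"
    and eq: "\<And>u. cantor_act f u = cantor_act g u"
  shows "f = g"
proof
  fix t
  show "f t = g t"
  proof (cases "t \<in> {0..1}")
    case True
    then obtain u where "bin_val u = t" by (rule bin_val_surj)
    then show ?thesis using cantor_act_spec(1)[OF f, of u] cantor_act_spec(1)[OF g, of u] eq by simp
  next
    case False
    then show ?thesis using f g by (auto simp: thompsonF_simps dyadic_homeo_def)
  qed
qed

lemma replaces_append: "replaces f p q \<Longrightarrow> replaces f (p @ s) (q @ s)"
  by (simp add: replaces_def)

lemma replaces_mult:
  "f \<in> carrier thompsonF \<Longrightarrow> g \<in> carrier thompsonF \<Longrightarrow> replaces f p q \<Longrightarrow> replaces g q r \<Longrightarrow>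
   replaces (f \<otimes>\<^bsub>thompsonF\<^esub> g) p r"
  by (simp add: replaces_def cantor_act_mult)

lemma replaces_inv: "f \<in> carrier thompsonF \<Longrightarrow> replaces f p q \<Longrightarrow> replaces (inv\<^bsub>thompsonF\<^esub> f) q p"
  by (simp add: replaces_def cantor_act_inv_eqI)

lemma replaces_one: "replaces \<one>\<^bsub>thompsonF\<^esub> p p"
  by (simp add: replaces_def)

section \<open>Tilings by cylinders and binary trees\<close>

definition lo :: "bool list \<Rightarrow> real" where "lo q = bin_val (q @- sconst False)"
definition hi :: "bool list \<Rightarrow> real" where "hi q = bin_val (q @- sconst True)"

lemma lo_hi_Nil [simp]: "lo [] = 0" "hi [] = 1"
  by (simp_all add: lo_def hi_def)

lemma lo_hi_Cons [simp]: "lo (c # q) = (of_bool c + lo q) / 2" "hi (c # q) = (of_bool c + hi q) / 2"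
  by (simp_all add: lo_def hi_def bin_val_SCons)

lemma lo_less_hi: "lo q < hi q"
  by (induction q) auto

lemma lo_ge_0: "0 \<le> lo q" and hi_le_1: "hi q \<le> 1"
  by (simp_all add: lo_def hi_def bin_val_ge_0 bin_val_le_1)

lemma replaces_lo_hi:
  assumes "f \<in> carrier thompsonF" "replaces f p q"
  shows "f (lo p) = lo q" "f (hi p) = hi q"
  using assms by (simp_all add: replaces_def lo_def hi_def flip: cantor_act_spec)

text \<open>Two cylinder intervals are nested or have disjoint interiors.\<close>
lemma prefix_of_interval_subset:
  "lo r \<le> lo q \<Longrightarrow> hi q \<le> hi r \<Longrightarrow> \<exists>s. q = r @ s"
proof (induction r arbitrary: q)
  case (Cons c r)
  show ?case
  proof (cases q)
    case Nil
    then show ?thesis using Cons.prems lo_less_hi[of r] lo_ge_0[of r] hi_le_1[of r] by (cases c) auto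
  next
    case (Cons d q')
    have "d = c"
      using Cons.prems lo_less_hi[of q'] lo_ge_0[of q'] hi_le_1[of q'] lo_ge_0[of r] hi_le_1[of r]
      unfolding Cons by (cases c; cases d) auto
    then show ?thesis using Cons.IH[of q'] Cons.prems unfolding Cons by auto
  qed
qed simp

fun tiles :: "real \<Rightarrow> bool list list \<Rightarrow> real \<Rightarrow> bool" where
  "tiles x [] y \<longleftrightarrow> x = y"
| "tiles x (q # qs) y \<longleftrightarrow> x = lo q \<and> tiles (hi q) qs y"

lemma tiles_append: "tiles x (ps @ qs) z \<longleftrightarrow> (\<exists>y. tiles x ps y \<and> tiles y qs z)"
  by (induction ps arbitrary: x) auto

lemma tiles_le: "tiles x qs y \<Longrightarrow> x \<le> y"
proof (induction qs arbitrary: x)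
  case (Cons q qs)
  then show ?case using lo_less_hi[of q] by fastforce
qed simp

lemma tiles_less: "tiles x qs y \<Longrightarrow> qs \<noteq> [] \<Longrightarrow> x < y"
  by (cases qs) (auto intro: less_le_trans[OF lo_less_hi tiles_le])

lemma tiles_bounds: "tiles x qs y \<Longrightarrow> q \<in> set qs \<Longrightarrow> x \<le> lo q \<and> hi q \<le> y"
proof (induction qs arbitrary: x)
  case (Cons p qs)
  then have "p = q \<or> hi p \<le> lo q \<and> hi q \<le> y" "lo p < hi p" "hi p \<le> y" "x = lo p"
    using tiles_le lo_less_hi by auto
  then show ?case by auto
qed simp

lemma tiles_upper: "tiles x qs y \<Longrightarrow> (\<And>q. q \<in> set qs \<Longrightarrow> hi q \<le> B) \<Longrightarrow> x \<le> B \<Longrightarrow> y \<le> B"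
  by (induction qs arbitrary: x) auto

lemma tiles_lower: "tiles x qs y \<Longrightarrow> (\<And>q. q \<in> set qs \<Longrightarrow> B \<le> lo q) \<Longrightarrow> B \<le> y \<Longrightarrow> B \<le> x"
  by (cases qs) auto

lemma tiles_Cons_word:
  "tiles ((of_bool c + x) / 2) (map ((#) c) qs) ((of_bool c + y) / 2) \<longleftrightarrow> tiles x qs y"
  by (induction qs arbitrary: x) auto

text \<open>Prefixing \<open>r\<close> is the affine map of the unit interval onto the cylinder of \<open>r\<close>, so it preserves tilings.\<close>
lemma tiles_append_word: "tiles (lo r) (map ((@) r) qs) (hi r) \<longleftrightarrow> tiles 0 qs 1"
proof (induction r arbitrary: qs)
  case (Cons c r)
  have "tiles (lo (c # r)) (map ((#) c) (map ((@) r) qs)) (hi (c # r)) \<longleftrightarrow> tiles (lo r) (map ((@) r) qs) (hi r)"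
    unfolding lo_hi_Cons by (rule tiles_Cons_word)
  then show ?case using Cons.IH by (simp add: o_def)
qed (simp add: map_idI)

datatype dtree = Leaf | Node dtree dtree

fun leaves :: "dtree \<Rightarrow> bool list list" where
  "leaves Leaf = [[]]"
| "leaves (Node A B) = map ((#) False) (leaves A) @ map ((#) True) (leaves B)"

lemma length_leaves: "length (leaves A) = Suc (size A)"
  by (induction A) auto

lemma tiles_leaves: "tiles 0 (leaves A) 1"
proof (induction A)
  case (Node A B)
  then show ?case
    using tiles_Cons_word[of False 0 "leaves A" 1] tiles_Cons_word[of True 0 "leaves B" 1]
    by (auto simp: tiles_append)
qed simp

lemma leaf_prefix: "\<exists>p\<in>set (leaves A). \<exists>u. v = p @- u"
proof (induction A arbitrary: v)
  case (Node A B)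
  obtain c v' where v: "v = c ## v'" by (metis stream.exhaust)
  show ?case
  proof (cases c)
    case True
    obtain p u where "p \<in> set (leaves B)" "v' = p @- u" using Node.IH(2) by blast
    then show ?thesis using True v by (auto intro!: bexI[of _ "True # p"])
  next
    case False
    obtain p u where "p \<in> set (leaves A)" "v' = p @- u" using Node.IH(1) by blast
    then show ?thesis using False v by (auto intro!: bexI[of _ "False # p"])
  qed
qed simp

text \<open>A tiling of the unit interval by at least two cylinders has a break at 1/2, because no proper cylinder
  contains 1/2 in its interior.\<close>
lemma tiles_split:
  assumes "tiles 0 qs 1" "[] \<notin> set qs"
  shows "\<exists>as bs. qs = map ((#) False) as @ map ((#) True) bs \<and> tiles 0 as 1 \<and> tiles 0 bs 1 \<and> as \<noteq> [] \<and> bs \<noteq> []"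
proof -
  define fs ts where "fs = takeWhile (\<lambda>q. \<not> hd q) qs" and "ts = dropWhile (\<lambda>q. \<not> hd q) qs"
  have qs: "qs = fs @ ts" by (simp add: fs_def ts_def)
  then obtain y where y: "tiles 0 fs y" "tiles y ts 1" using assms(1) tiles_append by auto
  have fs: "q = False # tl q" if "q \<in> set fs" for q
  proof -
    have "q \<in> set qs" "\<not> hd q" using set_takeWhileD[of q "\<lambda>q. \<not> hd q" qs] that by (auto simp: fs_def)
    moreover have "q \<noteq> []" using assms(2) calculation(1) by metis
    ultimately show ?thesis by (metis list.collapse)
  qed
  \<comment> \<open>to the right of the first word that starts with 1, all cylinders lie beyond 1/2\<close>
  have ts: "q = True # tl q" if q: "q \<in> set ts" for q
  proof -
    obtain b ts' where b: "ts = b # ts'" using q by (cases ts) auto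
    have "hd b" using b hd_dropWhile[of "\<lambda>q. \<not> hd q" qs] unfolding ts_def by fastforce
    moreover have "b \<noteq> []" using assms(2) qs b by auto
    ultimately have "1/2 \<le> lo b" using lo_ge_0[of "tl b"] by (cases b) auto
    moreover have "lo b \<le> lo q" using y(2) tiles_bounds[of y ts 1 q] q b by auto
    ultimately have "1/2 < hi q" using lo_less_hi[of q] by linarith
    moreover have "q \<noteq> []" using assms(2) qs q by auto
    ultimately show ?thesis using hi_le_1[of "tl q"] by (cases q; cases "hd q") auto
  qed
  have "y \<le> 1/2"
  proof (rule tiles_upper[OF y(1)])
    fix q assume "q \<in> set fs"
    from fs[OF this] show "hi q \<le> 1/2"
      using lo_hi_Cons(2)[of False "tl q"] hi_le_1[of "tl q"] by simp
  qed simp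
  moreover have "1/2 \<le> y"
  proof (rule tiles_lower[OF y(2)])
    fix q assume "q \<in> set ts"
    from ts[OF this] show "1/2 \<le> lo q"
      using lo_hi_Cons(1)[of True "tl q"] lo_ge_0[of "tl q"] by simp
  qed simp
  ultimately have y_eq: "y = 1/2" by simp
  have fs': "fs = map ((#) False) (map tl fs)"
    using fs by (auto intro!: map_idI[symmetric])
  have ts': "ts = map ((#) True) (map tl ts)"
    using ts by (auto intro!: map_idI[symmetric])
  have "tiles 0 (map tl fs) 1"
    using y(1) tiles_Cons_word[of False 0 "map tl fs" 1] unfolding y_eq fs'[symmetric] by simp
  moreover have "tiles 0 (map tl ts) 1"
    using y(2) tiles_Cons_word[of True 0 "map tl ts" 1] unfolding y_eq ts'[symmetric] by simp
  moreover have "map tl fs \<noteq> []" "map tl ts \<noteq> []" using y y_eq by auto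
  ultimately show ?thesis using qs fs' ts' by metis
qed

text \<open>Splitting at 1/2 and recursing yields the tree; the total length of the words decreases.\<close>
lemma tiles_imp_leaves: "tiles 0 qs 1 \<Longrightarrow> \<exists>A. leaves A = qs"
proof (induction "sum_list (map length qs)" arbitrary: qs rule: less_induct)
  case less
  show ?case
  proof (cases "[] \<in> set qs")
    case True
    then obtain as bs where qs: "qs = as @ [] # bs" by (meson split_list)
    then have t: "tiles 0 as 0" "tiles 1 bs 1" using less.prems by (auto simp: tiles_append)
    have "as = []" "bs = []" using tiles_less[OF t(1)] tiles_less[OF t(2)] by auto
    then have "leaves Leaf = qs" using qs by simp
    then show ?thesis by blast
  next
    case False
    obtain as bs where ab: "qs = map ((#) False) as @ map ((#) True) bs"
      "tiles 0 as 1" "tiles 0 bs 1" "as \<noteq> []" "bs \<noteq> []"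
      using tiles_split[OF less.prems False] by blast
    have "sum_list (map length (map ((#) c) cs)) = sum_list (map length cs) + length cs" for c :: bool and cs
      by (induction cs) auto
    then have "sum_list (map length as) < sum_list (map length qs)" "sum_list (map length bs) < sum_list (map length qs)"
      using ab by auto
    then obtain A B where "leaves A = as" "leaves B = bs" using less.hyps ab by blast
    then have "leaves (Node A B) = qs" using ab by simp
    then show ?thesis by blast
  qed
qed

fun complete_tree :: "nat \<Rightarrow> dtree" where
  "complete_tree 0 = Leaf"
| "complete_tree (Suc n) = Node (complete_tree n) (complete_tree n)"

lemma length_complete_tree: "p \<in> set (leaves (complete_tree n)) \<Longrightarrow> length p = n"
  by (induction n arbitrary: p) auto

text \<open>If \<open>f\<close> fixes the end points of the cylinder of \<open>r\<close>, it acts inside this cylinder as a pair of trees. For the first tree take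
  the complete tree of large depth: \<open>f\<close> maps the cylinders of its leaves to cylinders, which
  tile again and hence are the leaves of the second tree.\<close>
lemma fixed_cylinder_tree_pair:
  assumes f: "f \<in> carrier thompsonF" and fix_lo: "f (lo r) = lo r" and fix_hi: "f (hi r) = hi r"
  obtains A B where "list_all2 (\<lambda>p q. replaces f (r @ p) (r @ q)) (leaves A) (leaves B)"
proof -
  obtain m where m: "\<And>p. length p \<ge> m \<Longrightarrow> \<exists>q. replaces f p q"
    using carrier_replaces[OF f] by blast
  define P where "P = leaves (complete_tree m)"
  have "\<exists>q. replaces f (r @ p) q" if "p \<in> set P" for p
    using m[of "r @ p"] length_complete_tree[of p m] that by (simp add: P_def)
  then obtain \<phi> where \<phi>: "\<And>p. p \<in> set P \<Longrightarrow> replaces f (r @ p) (\<phi> p)" by metis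
  have image: "tiles (f x) (map \<phi> ps) (f y)" if "tiles x (map ((@) r) ps) y" "set ps \<subseteq> set P" for ps x y
    using that
  proof (induction ps arbitrary: x)
    case (Cons p ps)
    then have "p \<in> set P" "x = lo (r @ p)" "tiles (hi (r @ p)) (map ((@) r) ps) y" by auto
    then show ?case using Cons.IH Cons.prems(2) replaces_lo_hi[OF f \<phi>[OF \<open>p \<in> set P\<close>]] by fastforce
  qed simp
  have t: "tiles (lo r) (map \<phi> P) (hi r)"
    using image[of "lo r" P "hi r"] tiles_leaves tiles_append_word fix_lo fix_hi by (simp add: P_def)
  have "\<exists>q. \<phi> p = r @ q" if "p \<in> set P" for p
    using tiles_bounds[OF t, of "\<phi> p"] that by (intro prefix_of_interval_subset) auto
  then obtain \<psi> where \<psi>: "\<And>p. p \<in> set P \<Longrightarrow> \<phi> p = r @ \<psi> p" by metis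
  then have "map \<phi> P = map ((@) r) (map \<psi> P)" by simp
  then obtain B where B: "leaves B = map \<psi> P"
    using t tiles_append_word tiles_imp_leaves by metis
  have "replaces f (r @ p) (r @ \<psi> p)" if "p \<in> set P" for p
    using \<phi>[OF that] \<psi>[OF that] by simp
  then have "list_all2 (\<lambda>p q. replaces f (r @ p) (r @ q)) P (map \<psi> P)"
    by (auto simp: list_all2_conv_all_nth)
  then show thesis using that[of "complete_tree m" B] B by (simp add: P_def)
qed

section \<open>Copies of an element inside a cylinder\<close>

text \<open>For \<open>r = 1\<close> this is the shift of F that sends each \<open>x_n\<close> to \<open>x_(n+1)\<close>.\<close>
definition acts_below :: "bool list \<Rightarrow> (real \<Rightarrow> real) \<Rightarrow> (real \<Rightarrow> real) \<Rightarrow> bool" where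
  "acts_below r g h \<longleftrightarrow> (\<forall>u. cantor_act h (r @- u) = r @- cantor_act g u) \<and>
     (\<forall>v. (\<nexists>u. v = r @- u) \<longrightarrow> cantor_act h v = v)"

lemma acts_below_one: "acts_below r \<one>\<^bsub>thompsonF\<^esub> \<one>\<^bsub>thompsonF\<^esub>"
  by (simp add: acts_below_def)

lemma acts_below_mult:
  assumes "g \<in> carrier thompsonF" "h \<in> carrier thompsonF" "g' \<in> carrier thompsonF" "h' \<in> carrier thompsonF"
    and "acts_below r g h" "acts_below r g' h'"
  shows "acts_below r (g \<otimes>\<^bsub>thompsonF\<^esub> g') (h \<otimes>\<^bsub>thompsonF\<^esub> h')"
  using assms by (simp add: acts_below_def cantor_act_mult)

lemma acts_below_inv:
  assumes "g \<in> carrier thompsonF" "h \<in> carrier thompsonF" and a: "acts_below r g h"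
  shows "acts_below r (inv\<^bsub>thompsonF\<^esub> g) (inv\<^bsub>thompsonF\<^esub> h)"
  unfolding acts_below_def
  using assms by (auto simp: acts_below_def cantor_act_inv intro!: cantor_act_inv_eqI)

text \<open>Conjugation by an element that moves one cylinder to another transports copies.\<close>
lemma acts_below_conj:
  assumes h: "h \<in> carrier thompsonF" and k: "k \<in> carrier thompsonF"
    and rep: "replaces k r s" and a: "acts_below s g h"
  shows "acts_below r g (k \<otimes>\<^bsub>thompsonF\<^esub> h \<otimes>\<^bsub>thompsonF\<^esub> inv\<^bsub>thompsonF\<^esub> k)"
proof -
  have "\<nexists>u. cantor_act k v = s @- u" if "\<nexists>u. v = r @- u" for v
    using that rep cantor_act_inv(1)[OF k] unfolding replaces_def by metis
  then show ?thesis
    using rep a h k unfolding acts_below_def replaces_def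
    by (auto simp: cantor_act_mult cantor_act_inv intro!: cantor_act_inv_eqI)
qed

text \<open>If \<open>h\<close> is itself a copy of \<open>g\<close> below \<open>s\<close>, a copy of \<open>g\<close> below \<open>rs\<close> is a copy of \<open>h\<close> below \<open>r\<close>. Since \<open>x1\<close> is the
  copy of \<open>x0\<close> below 1, this recognizes copies of \<open>x1\<close> among copies of \<open>x0\<close>.\<close>
lemma acts_below_cancel:
  assumes k: "acts_below (r @ s) g k" and h: "acts_below s g h"
  shows "acts_below r h k"
  unfolding acts_below_def
proof (intro conjI allI impI)
  fix u :: "bool stream"
  show "cantor_act k (r @- u) = r @- cantor_act h u"
  proof (cases "\<exists>w. u = s @- w")
    case True
    then show ?thesis using k h by (auto simp: acts_below_def simp flip: shift_append)
  next
    case False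
    then have "\<nexists>w. r @- u = (r @ s) @- w" by auto
    then show ?thesis using False k h by (auto simp: acts_below_def)
  qed
next
  fix v assume "\<nexists>u. v = r @- u"
  then have "\<nexists>u. v = (r @ s) @- u" by auto
  then show "cantor_act k v = v" using k by (auto simp: acts_below_def)
qed

lemma acts_below_replaces: "acts_below r g h \<Longrightarrow> replaces g p q \<Longrightarrow> replaces h (r @ p) (r @ q)"
  by (simp add: acts_below_def replaces_def)

lemma generate_carrier: "S \<subseteq> carrier thompsonF \<Longrightarrow> g \<in> generate thompsonF S \<Longrightarrow> g \<in> carrier thompsonF"
  using F.generate_in_carrier by blast

text \<open>Copying is multiplicative, so a subgroup that contains copies of generators contains copies of all that they
  generate.\<close>
lemma acts_below_generate:
  assumes S: "S \<subseteq> carrier thompsonF" and K: "subgroup K thompsonF"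
    and gens: "\<And>s. s \<in> S \<Longrightarrow> \<exists>h\<in>K. acts_below r s h"
    and g: "g \<in> generate thompsonF S"
  shows "\<exists>h\<in>K. acts_below r g h"
  using g
proof (induction rule: generate.induct)
  case one
  then show ?case using acts_below_one subgroup.one_closed[OF K] by blast
next
  case (incl h)
  then show ?case by (rule gens)
next
  case (inv h)
  then obtain k where k: "k \<in> K" "acts_below r h k" using gens by blast
  have "h \<in> carrier thompsonF" using inv S by blast
  from acts_below_inv[OF this subgroup.mem_carrier[OF K k(1)] k(2)]
  show ?case using subgroup.m_inv_closed[OF K k(1)] by blast
next
  case (eng g g')
  then obtain h h' where h: "h \<in> K" "acts_below r g h" and h': "h' \<in> K" "acts_below r g' h'" by blast
  have "g \<in> carrier thompsonF" "g' \<in> carrier thompsonF"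
    using eng.hyps generate_carrier[OF S] by blast+
  from acts_below_mult[OF this(1) subgroup.mem_carrier[OF K h(1)] this(2) subgroup.mem_carrier[OF K h'(1)] h(2) h'(2)]
  show ?case using subgroup.m_closed[OF K h(1) h'(1)] by blast
qed

section \<open>The given elements as copies of generators\<close>

lemma x0_acts: "replaces x0 [False] [False, False]" "replaces x0 [True, False] [False, True]"
  "replaces x0 [True, True] [True]"
  by (simp_all add: replaces_def cantor_act_x0)

lemma x1_acts_below: "acts_below [True] x0 x1"
  unfolding acts_below_def
proof (intro conjI allI impI)
  fix u :: "bool stream"
  obtain a b v where u: "u = a ## b ## v" by (metis stream.exhaust)
  show "cantor_act x1 ([True] @- u) = [True] @- cantor_act x0 u"
    by (cases a; cases b) (auto simp: u cantor_act_x0 cantor_act_x1)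
next
  fix v assume v: "\<nexists>u. v = [True] @- u"
  obtain a u where "v = a ## u" by (metis stream.exhaust)
  then show "cantor_act x1 v = v" using v by (cases a) (auto simp: cantor_act_x1)
qed

lemma xn_2: "xn 2 = x0 \<otimes>\<^bsub>thompsonF\<^esub> x1 \<otimes>\<^bsub>thompsonF\<^esub> inv\<^bsub>thompsonF\<^esub> x0"
  by (simp add: xn_def F.int_pow_neg)

lemma xn_3: "xn 3 = x0 \<otimes>\<^bsub>thompsonF\<^esub> xn 2 \<otimes>\<^bsub>thompsonF\<^esub> inv\<^bsub>thompsonF\<^esub> x0"
proof -
  have "x0 [^]\<^bsub>thompsonF\<^esub> (2::int) = x0 \<otimes>\<^bsub>thompsonF\<^esub> x0"
    using F.int_pow_mult[of x0 1 1] by simp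
  then show ?thesis by (simp add: xn_2 xn_def[of 3] F.int_pow_neg F.m_assoc F.inv_mult_group)
qed

lemma y1_carrier [simp]: "y1 \<in> carrier thompsonF"
  by (simp add: y1_def)

lemma y1_eq: "y1 = inv\<^bsub>thompsonF\<^esub> x0 \<otimes>\<^bsub>thompsonF\<^esub> inv\<^bsub>thompsonF\<^esub> x0 \<otimes>\<^bsub>thompsonF\<^esub> x1 \<otimes>\<^bsub>thompsonF\<^esub> x0"
proof -
  have "x0 [^]\<^bsub>thompsonF\<^esub> (-2::int) = inv\<^bsub>thompsonF\<^esub> x0 \<otimes>\<^bsub>thompsonF\<^esub> inv\<^bsub>thompsonF\<^esub> x0"
    using F.int_pow_mult[of x0 "-1" "-1"] by (simp add: F.int_pow_neg)
  then show ?thesis by (simp add: y1_def)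
qed

lemma y2_eq: "y2 = inv\<^bsub>thompsonF\<^esub> x0 \<otimes>\<^bsub>thompsonF\<^esub> y1 \<otimes>\<^bsub>thompsonF\<^esub> x0"
proof -
  have "x0 [^]\<^bsub>thompsonF\<^esub> (-3::int) = inv\<^bsub>thompsonF\<^esub> x0 \<otimes>\<^bsub>thompsonF\<^esub> x0 [^]\<^bsub>thompsonF\<^esub> (-2::int)"
    using F.int_pow_mult[of x0 "-1" "-2"] by (simp add: F.int_pow_neg)
  moreover have "x0 [^]\<^bsub>thompsonF\<^esub> (2::int) = x0 \<otimes>\<^bsub>thompsonF\<^esub> x0"
    using F.int_pow_mult[of x0 1 1] by simp
  ultimately show ?thesis by (simp add: y2_def y1_def F.m_assoc)
qed

lemma xn_carrier [simp]: "xn 2 \<in> carrier thompsonF" "xn 3 \<in> carrier thompsonF"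
  by (simp_all add: xn_2 xn_3)

lemma y2_carrier [simp]: "y2 \<in> carrier thompsonF"
  by (simp add: y2_eq)

lemma x0_inv_acts:
  "cantor_act (inv\<^bsub>thompsonF\<^esub> x0) (False ## False ## u) = False ## u"
  "cantor_act (inv\<^bsub>thompsonF\<^esub> x0) (False ## True ## u) = True ## False ## u"
  "cantor_act (inv\<^bsub>thompsonF\<^esub> x0) (True ## u) = True ## True ## u"
  by (rule cantor_act_inv_eqI; simp add: cantor_act_x0)+

lemma x1_inv_acts:
  "cantor_act (inv\<^bsub>thompsonF\<^esub> x1) (False ## u) = False ## u"
  "cantor_act (inv\<^bsub>thompsonF\<^esub> x1) (True ## False ## False ## u) = True ## False ## u"
  "cantor_act (inv\<^bsub>thompsonF\<^esub> x1) (True ## False ## True ## u) = True ## True ## False ## u"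
  "cantor_act (inv\<^bsub>thompsonF\<^esub> x1) (True ## True ## u) = True ## True ## True ## u"
  by (rule cantor_act_inv_eqI; simp add: cantor_act_x1)+

lemma y1_acts_below: "acts_below [False] (inv\<^bsub>thompsonF\<^esub> x0) y1"
  unfolding acts_below_def
proof (intro conjI allI impI)
  fix u :: "bool stream"
  obtain a b v where u: "u = a ## b ## v" by (metis stream.exhaust)
  show "cantor_act y1 ([False] @- u) = [False] @- cantor_act (inv\<^bsub>thompsonF\<^esub> x0) u"
    by (cases a; cases b) (auto simp: u y1_eq cantor_act_mult cantor_act_x0 cantor_act_x1 x0_inv_acts)
next
  fix v assume v: "\<nexists>u. v = [False] @- u"
  obtain a u where "v = a ## u" by (metis stream.exhaust)
  then show "cantor_act y1 v = v" using v
    by (cases a) (auto simp: y1_eq cantor_act_mult cantor_act_x0 cantor_act_x1 x0_inv_acts)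
qed

lemma x2_acts_below: "acts_below [True, True] x0 (xn 2)" "acts_below [True] x1 (xn 2)"
proof -
  show "acts_below [True, True] x0 (xn 2)"
    unfolding xn_2 by (rule acts_below_conj[OF _ _ x0_acts(3) x1_acts_below]) auto
  then show "acts_below [True] x1 (xn 2)"
    using acts_below_cancel[of "[True]" "[True]"] x1_acts_below by simp
qed

lemma x3_acts_below: "acts_below [True, True] x1 (xn 3)"
proof -
  have "replaces x0 [True, True, True] [True, True]"
    using replaces_append[OF x0_acts(3), of "[True]"] by simp
  then have "acts_below [True, True, True] x0 (xn 3)"
    unfolding xn_3 by (intro acts_below_conj[OF _ _ _ x2_acts_below(1)]) auto
  then show ?thesis
    using acts_below_cancel[of "[True, True]" "[True]"] x1_acts_below by simp
qed

lemma y2_acts_below: "acts_below [False] y1 y2"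
proof -
  have "replaces (inv\<^bsub>thompsonF\<^esub> x0) [False, False] [False]"
    by (intro replaces_inv x0_acts) simp
  then have "acts_below [False, False] (inv\<^bsub>thompsonF\<^esub> x0) (inv\<^bsub>thompsonF\<^esub> x0 \<otimes>\<^bsub>thompsonF\<^esub> y1 \<otimes>\<^bsub>thompsonF\<^esub> inv\<^bsub>thompsonF\<^esub> (inv\<^bsub>thompsonF\<^esub> x0))"
    by (intro acts_below_conj[OF _ _ _ y1_acts_below]) auto
  then have "acts_below [False, False] (inv\<^bsub>thompsonF\<^esub> x0) y2" by (simp add: y2_eq)
  then show ?thesis
    using acts_below_cancel[of "[False]" "[False]"] y1_acts_below by simp
qed

lemma x0_copy_below_0: "acts_below [False] x0 (inv\<^bsub>thompsonF\<^esub> y1)"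
  using acts_below_inv[OF _ _ y1_acts_below] by simp

text \<open>Below 0, \<open>y1\<close> is the copy of \<open>x0^-1\<close> and \<open>y2\<close> the copy of \<open>y1\<close>; so the formula for \<open>x1\<close> in terms of \<open>x0\<close> and \<open>y1\<close>
  can be copied.\<close>
lemma x1_copy_below_0:
  "acts_below [False] x1 (inv\<^bsub>thompsonF\<^esub> y1 \<otimes>\<^bsub>thompsonF\<^esub> inv\<^bsub>thompsonF\<^esub> y1 \<otimes>\<^bsub>thompsonF\<^esub> y2 \<otimes>\<^bsub>thompsonF\<^esub> y1)"
proof -
  have "x1 = x0 \<otimes>\<^bsub>thompsonF\<^esub> x0 \<otimes>\<^bsub>thompsonF\<^esub> y1 \<otimes>\<^bsub>thompsonF\<^esub> inv\<^bsub>thompsonF\<^esub> x0"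
    by (rule cantor_act_faithful) (simp_all add: y1_eq cantor_act_mult cantor_act_inv)
  then show ?thesis
    using acts_below_mult x0_copy_below_0 y1_acts_below y2_acts_below
    by (metis F.inv_closed F.m_closed x0_carrier y1_carrier y2_carrier)
qed

section \<open>Trees of equal size\<close>

abbreviation gen01 :: "(real \<Rightarrow> real) set" where
  "gen01 \<equiv> generate thompsonF {x0, x1}"

lemma gen01_subgroup: "subgroup gen01 thompsonF"
  by (rule F.generate_is_subgroup) auto

lemma y_gen01: "y1 \<in> gen01" "y2 \<in> gen01"
proof -
  have x: "x0 \<in> gen01" "x1 \<in> gen01" by (auto intro: generate.incl)
  note c = subgroup.m_closed[OF gen01_subgroup] subgroup.m_inv_closed[OF gen01_subgroup]
  show "y1 \<in> gen01" unfolding y1_eq by (intro c x)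
  then show "y2 \<in> gen01" unfolding y2_eq by (intro c x)
qed

text \<open>The group generated by \<open>x0\<close> and \<open>x1\<close> contains its own copies below 0 and below 1; this allows
  working in a subtree without leaving the group.\<close>
lemma gen01_copies:
  assumes "g \<in> gen01"
  shows "\<exists>h\<in>gen01. acts_below [c] g h"
proof (rule acts_below_generate[OF _ gen01_subgroup _ assms])
  have x: "x0 \<in> gen01" "x1 \<in> gen01" by (auto intro: generate.incl)
  note c = subgroup.m_closed[OF gen01_subgroup] subgroup.m_inv_closed[OF gen01_subgroup]
  show "{x0, x1} \<subseteq> carrier thompsonF" by simp
  fix s assume "s \<in> {x0, x1}"
  then consider "s = x0" | "s = x1" by blast
  then show "\<exists>h\<in>gen01. acts_below [c] s h"
  proof cases
    case 1
    show ?thesis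
    proof (cases c)
      case True
      show ?thesis unfolding 1 by (rule bexI[of _ x1]) (use True x1_acts_below x in auto)
    next
      case False
      show ?thesis unfolding 1
        by (rule bexI[of _ "inv\<^bsub>thompsonF\<^esub> y1"]) (use False x0_copy_below_0 in \<open>auto intro: c y_gen01\<close>)
    qed
  next
    case 2
    show ?thesis
    proof (cases c)
      case True
      show ?thesis unfolding 2 
        by (rule bexI[of _ "xn 2"]) (use True x2_acts_below in \<open>auto simp: xn_2 intro!: c x\<close>)
    next
      case False
      show ?thesis unfolding 2
        by (rule bexI[OF _ c(1)[OF c(1)[OF c(1)]]]) (use False x1_copy_below_0 in \<open>auto intro!: c y_gen01\<close>)
    qed
  qed
qed

definition carries :: "(real \<Rightarrow> real) \<Rightarrow> dtree \<Rightarrow> dtree \<Rightarrow> bool" where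
  "carries g A B \<longleftrightarrow> list_all2 (replaces g) (leaves A) (leaves B)"

lemma carries_one: "carries \<one>\<^bsub>thompsonF\<^esub> A A"
  by (simp add: carries_def replaces_one list_all2_refl)

lemma carries_mult:
  "g \<in> carrier thompsonF \<Longrightarrow> h \<in> carrier thompsonF \<Longrightarrow> carries g A B \<Longrightarrow> carries h B C \<Longrightarrow>
   carries (g \<otimes>\<^bsub>thompsonF\<^esub> h) A C"
  unfolding carries_def by (rule list_all2_trans[of "replaces g" "replaces h"]) (auto intro: replaces_mult)

lemma carries_inv:
  "g \<in> carrier thompsonF \<Longrightarrow> carries g A B \<Longrightarrow> carries (inv\<^bsub>thompsonF\<^esub> g) B A"
  unfolding carries_def by (auto simp: list_all2_conv_all_nth intro: replaces_inv)

text \<open>\<open>x0\<close> is the rotation of binary trees.\<close>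
lemma carries_x0: "carries x0 (Node A (Node B C)) (Node (Node A B) C)"
proof -
  have r: "replaces x0 (False # p) (False # False # p)" "replaces x0 (True # False # p) (False # True # p)"
    "replaces x0 (True # True # p) (True # p)" for p
    using x0_acts by (auto dest: replaces_append[where s = p])
  show ?thesis
    unfolding carries_def
    by (auto intro!: list_all2_appendI simp: list_all2_map1 list_all2_map2 r list_all2_refl)
qed

definition gen01_equiv :: "dtree \<Rightarrow> dtree \<Rightarrow> bool" where
  "gen01_equiv A B \<longleftrightarrow> (\<exists>g\<in>gen01. carries g A B)"

lemma gen01_carrier: "g \<in> gen01 \<Longrightarrow> g \<in> carrier thompsonF"
  using subgroup.mem_carrier[OF gen01_subgroup] .

lemma gen01_equiv_refl: "gen01_equiv A A"
  unfolding gen01_equiv_def using carries_one generate.one by blast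

lemma gen01_equiv_sym: "gen01_equiv A B \<Longrightarrow> gen01_equiv B A"
  unfolding gen01_equiv_def
  using carries_inv subgroup.m_inv_closed[OF gen01_subgroup] gen01_carrier by blast

lemma gen01_equiv_trans [trans]: "gen01_equiv A B \<Longrightarrow> gen01_equiv B C \<Longrightarrow> gen01_equiv A C"
  unfolding gen01_equiv_def
  using carries_mult subgroup.m_closed[OF gen01_subgroup] gen01_carrier by blast

lemma acts_below_carries_Node:
  assumes g: "carries g A B"
  shows "acts_below [False] g h \<Longrightarrow> carries h (Node A C) (Node B C)"
    and "acts_below [True] g h \<Longrightarrow> carries h (Node C A) (Node C B)"
proof -
  assume h: "acts_below [False] g h"
  have "replaces h (False # p) (False # q)" if "replaces g p q" for p q
    using acts_below_replaces[OF h that] by simp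
  moreover have "replaces h (True # p) (True # p)" for p
    using h by (auto simp: acts_below_def replaces_def)
  ultimately show "carries h (Node A C) (Node B C)"
    using g unfolding carries_def
    by (auto intro!: list_all2_appendI simp: list_all2_map1 list_all2_map2 list_all2_refl elim!: list_all2_mono)
next
  assume h: "acts_below [True] g h"
  have "replaces h (True # p) (True # q)" if "replaces g p q" for p q
    using acts_below_replaces[OF h that] by simp
  moreover have "replaces h (False # p) (False # p)" for p
    using h by (auto simp: acts_below_def replaces_def)
  ultimately show "carries h (Node C A) (Node C B)"
    using g unfolding carries_def
    by (auto intro!: list_all2_appendI simp: list_all2_map1 list_all2_map2 list_all2_refl elim!: list_all2_mono)
qed

lemma gen01_equiv_Node:
  assumes "gen01_equiv A A'" "gen01_equiv B B'"
  shows "gen01_equiv (Node A B) (Node A' B')"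
proof -
  have "gen01_equiv (Node A B) (Node A' B)"
    using assms(1) gen01_copies acts_below_carries_Node(1) unfolding gen01_equiv_def by metis
  also have "gen01_equiv (Node A' B) (Node A' B')"
    using assms(2) gen01_copies acts_below_carries_Node(2) unfolding gen01_equiv_def by metis
  finally show ?thesis .
qed

fun vine :: "nat \<Rightarrow> dtree" where
  "vine 0 = Leaf"
| "vine (Suc n) = Node Leaf (vine n)"

text \<open>Each rotation moves one leaf of the left vine to the right spine.\<close>
lemma gen01_equiv_Node_vines: "gen01_equiv (Node (vine a) (vine b)) (vine (Suc (a + b)))"
proof (induction a)
  case 0
  then show ?case by (simp add: gen01_equiv_refl)
next
  case (Suc a)
  have "gen01_equiv (Node Leaf (Node (vine a) (vine b))) (Node (Node Leaf (vine a)) (vine b))"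
    unfolding gen01_equiv_def by (rule bexI[of _ x0]) (auto intro: carries_x0 generate.incl)
  then have "gen01_equiv (Node (vine (Suc a)) (vine b)) (Node Leaf (Node (vine a) (vine b)))"
    by (simp add: gen01_equiv_sym)
  also have "gen01_equiv \<dots> (Node Leaf (vine (Suc (a + b))))"
    by (rule gen01_equiv_Node[OF gen01_equiv_refl Suc.IH])
  finally show ?case by simp
qed

lemma gen01_equiv_vine: "gen01_equiv A (vine (size A))"
proof (induction A)
  case Leaf
  then show ?case by (simp add: gen01_equiv_refl)
next
  case (Node A B)
  have "gen01_equiv (Node A B) (Node (vine (size A)) (vine (size B)))"
    by (rule gen01_equiv_Node[OF Node.IH])
  also have "gen01_equiv \<dots> (vine (Suc (size A + size B)))" by (rule gen01_equiv_Node_vines)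
  finally show ?case by simp
qed

lemma gen01_equiv_same_size: "size A = size B \<Longrightarrow> gen01_equiv A B"
  using gen01_equiv_vine[of A] gen01_equiv_vine[of B] gen01_equiv_sym gen01_equiv_trans by metis

text \<open>This turns out to be the group of all elements that fix the cylinder of 10 pointwise.\<close>
abbreviation off_10_gen :: "(real \<Rightarrow> real) set" where
  "off_10_gen \<equiv> generate thompsonF {xn 2, xn 3, y1, y2}"

lemma off_10_gen_subgroup: "subgroup off_10_gen thompsonF"
  by (rule F.generate_is_subgroup) auto

lemma off_10_gen_copies:
  assumes "g \<in> gen01"
  shows "\<exists>h\<in>off_10_gen. acts_below [False] g h" "\<exists>h\<in>off_10_gen. acts_below [True, True] g h"
proof -
  have x: "xn 2 \<in> off_10_gen" "xn 3 \<in> off_10_gen" "y1 \<in> off_10_gen" "y2 \<in> off_10_gen"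
    by (auto intro: generate.incl)
  note c = subgroup.m_closed[OF off_10_gen_subgroup] subgroup.m_inv_closed[OF off_10_gen_subgroup]
  have "inv\<^bsub>thompsonF\<^esub> y1 \<in> off_10_gen"
    "inv\<^bsub>thompsonF\<^esub> y1 \<otimes>\<^bsub>thompsonF\<^esub> inv\<^bsub>thompsonF\<^esub> y1 \<otimes>\<^bsub>thompsonF\<^esub> y2 \<otimes>\<^bsub>thompsonF\<^esub> y1 \<in> off_10_gen"
    by (intro c x)+
  then show "\<exists>h\<in>off_10_gen. acts_below [False] g h"
    using x0_copy_below_0 x1_copy_below_0
    by (intro acts_below_generate[OF _ off_10_gen_subgroup _ assms]) auto
  show "\<exists>h\<in>off_10_gen. acts_below [True, True] g h"
    using x x2_acts_below(1) x3_acts_below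
    by (intro acts_below_generate[OF _ off_10_gen_subgroup _ assms]) auto
qed

text \<open>The restriction of \<open>f\<close> to a cylinder whose end points it fixes, extended by the identity. By the tree
  pair of \<open>f\<close> it agrees with the copy of an element generated by \<open>x0\<close> and \<open>x1\<close>.\<close>
lemma copy_of_fixed_cylinder:
  assumes f: "f \<in> carrier thompsonF" and "f (lo r) = lo r" "f (hi r) = hi r"
    and copies: "\<And>g. g \<in> gen01 \<Longrightarrow> \<exists>h\<in>K. acts_below r g h"
  shows "\<exists>h\<in>K. (\<forall>u. cantor_act h (r @- u) = cantor_act f (r @- u)) \<and>
     (\<forall>u. \<exists>w. cantor_act h (r @- u) = r @- w) \<and>
     (\<forall>v. (\<nexists>u. v = r @- u) \<longrightarrow> cantor_act h v = v)"
proof -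
  obtain A B where AB: "list_all2 (\<lambda>p q. replaces f (r @ p) (r @ q)) (leaves A) (leaves B)"
    using fixed_cylinder_tree_pair assms(1-3) by metis
  then have "size A = size B" using length_leaves[of A] length_leaves[of B] list_all2_lengthD by fastforce
  then obtain g where g: "g \<in> gen01" "carries g A B"
    using gen01_equiv_same_size unfolding gen01_equiv_def by blast
  obtain h where h: "h \<in> K" "acts_below r g h" using copies[OF g(1)] by blast
  have "cantor_act h (r @- u) = cantor_act f (r @- u)" for u
  proof -
    obtain p w where p: "p \<in> set (leaves A)" "u = p @- w" using leaf_prefix by blast
    then obtain i where i: "i < length (leaves A)" "p = leaves A ! i" by (auto simp: in_set_conv_nth)
    then have "replaces f (r @ p) (r @ leaves B ! i)" "replaces g p (leaves B ! i)"
      using AB g(2) by (auto simp: list_all2_conv_all_nth carries_def)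
    then show ?thesis using h(2) p(2) by (simp add: acts_below_def replaces_def)
  qed
  then show ?thesis using h unfolding acts_below_def by blast
qed

text \<open>An element that fixes the cylinder of 10 fixes 1/2 and 3/4, hence is the product of its
  restrictions to the cylinders of 0 and 11.\<close>
lemma generated_if_fixes_cylinder_10:
  assumes f: "f \<in> carrier thompsonF" and rep: "replaces f [True, False] [True, False]"
  shows "f \<in> off_10_gen"
proof -
  have f01: "f 0 = 0" "f 1 = 1" using f by (auto simp: thompsonF_simps dyadic_homeo_def)
  have mid: "f (1/2) = 1/2" "f (3/4) = 3/4"
    using replaces_lo_hi[OF f rep] by simp_all
  obtain h where h: "h \<in> off_10_gen" "\<And>u. cantor_act h ([False] @- u) = cantor_act f ([False] @- u)"
    "\<And>v. \<nexists>u. v = [False] @- u \<Longrightarrow> cantor_act h v = v"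
    using copy_of_fixed_cylinder[OF f, of "[False]" off_10_gen] off_10_gen_copies(1) f01 mid by auto
  obtain k where k: "k \<in> off_10_gen" "\<And>u. cantor_act k ([True, True] @- u) = cantor_act f ([True, True] @- u)"
    "\<And>u. \<exists>w. cantor_act k ([True, True] @- u) = [True, True] @- w"
    "\<And>v. \<nexists>u. v = [True, True] @- u \<Longrightarrow> cantor_act k v = v"
    using copy_of_fixed_cylinder[OF f, of "[True, True]" off_10_gen] off_10_gen_copies(2) f01 mid by auto
  note hc = subgroup.mem_carrier[OF off_10_gen_subgroup h(1)]
  note kc = subgroup.mem_carrier[OF off_10_gen_subgroup k(1)]
  have "f = k \<otimes>\<^bsub>thompsonF\<^esub> h"
  proof (rule cantor_act_faithful[OF f])
    fix u :: "bool stream"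
    obtain a b v where u: "u = a ## b ## v" by (metis stream.exhaust)
    show "cantor_act f u = cantor_act (k \<otimes>\<^bsub>thompsonF\<^esub> h) u"
    proof (cases a)
      case False
      then show ?thesis using h(2)[of "b ## v"] k(4)[of u] by (simp add: cantor_act_mult[OF kc hc] u)
    next
      case True
      show ?thesis
      proof (cases b)
        case b: True
        obtain w where "cantor_act k u = [True, True] @- w" using k(3)[of v] True b u by auto
        then have "cantor_act h (cantor_act k u) = cantor_act k u" by (intro h(3)) auto
        then show ?thesis using k(2)[of v] True b by (simp add: cantor_act_mult[OF kc hc] u)
      next
        case b: False
        have "cantor_act k u = u" "cantor_act h u = u" using True b u by (auto intro!: h(3) k(4))
        moreover have "cantor_act f u = u" using rep True b u by (simp add: replaces_def)
        ultimately show ?thesis by (simp add: cantor_act_mult[OF kc hc])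
      qed
    qed
  qed (use hc kc in auto)
  then show ?thesis using h(1) k(1) by (simp add: subgroup.m_closed[OF off_10_gen_subgroup])
qed

section \<open>Periods of primitive words\<close>

text \<open>A period gives a rotation of \<open>w\<close> that equals \<open>w\<close>, so a factorization of \<open>w\<close> into two commuting words. These
  are powers of a common word, so one of them is empty.\<close>
lemma period_of_primitive_cycle:
  assumes w: "w \<noteq> []" "\<not> proper_power w" and per: "sdrop n (cycle w) = cycle w"
  shows "length w dvd n"
proof -
  define r x y where "r = n mod length w" and "x = take r w" and "y = drop r w"
  have r: "r < length w" using w by (simp add: r_def)
  have "cycle (rotate r w) = cycle w"
    using per sdrop_cycle[OF w(1)] by (simp add: r_def)
  then have "stake (length w) (cycle (rotate r w)) = stake (length w) (cycle w)" by simp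
  then have "rotate r w = w"
    using w(1) stake_cycle_eq[of "rotate r w"] stake_cycle_eq[of w] by simp
  then have yx: "y @ x = w" using r by (simp add: rotate_drop_take x_def y_def)
  have xy: "x @ y = w" by (simp add: x_def y_def)
  obtain m k z where z: "concat (replicate m z) = x" "concat (replicate k z) = y"
    using comm_append_are_replicate[of x y] xy yx by auto
  have "r = 0"
  proof (rule ccontr)
    assume "r \<noteq> 0"
    then have "x \<noteq> []" "y \<noteq> []" using r w(1) by (auto simp: x_def y_def)
    then have "m \<ge> 1" "k \<ge> 1" using z by (cases m; cases k; auto)+
    moreover have "w = concat (replicate (m + k) z)" using xy z by (simp add: replicate_add)
    ultimately show False using w(2) unfolding proper_power_def by (metis add_mono one_add_one)
  qed
  then show ?thesis by (simp add: r_def mod_eq_0_iff_dvd)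
qed

lemma power_shift_cycle: "w \<noteq> [] \<Longrightarrow> concat (replicate k w) @- cycle w = cycle w"
  by (induction k) (auto simp flip: cycle_decomp)

lemma prefix_fixing_cycle:
  assumes w: "w \<noteq> []" "\<not> proper_power w" and eq: "q @- cycle w = cycle w"
  obtains l where "q = concat (replicate l w)"
proof -
  have "sdrop (length q) (q @- cycle w) = cycle w" by (simp add: sdrop_shift)
  then have "length w dvd length q" using period_of_primitive_cycle[OF w] eq by metis
  moreover have "stake (length q) (q @- cycle w) = q" by (simp add: stake_shift)
  ultimately have "q = concat (replicate (length q div length w) w)"
    using w(1) eq by (metis dvd_imp_mod_0 stake_cycle_eq_mod_0)
  then show thesis by (rule that)
qed

section \<open>The stabilizer of a periodic point behind 10\<close>

text \<open>This element erases the word \<open>w\<close> behind the prefix 10, letter by letter.\<close>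
abbreviation erase_word :: "bool list \<Rightarrow> real \<Rightarrow> real" where
  "erase_word w \<equiv> word_subst w (inv\<^bsub>thompsonF\<^esub> x1) (inv\<^bsub>thompsonF\<^esub> x1 \<otimes>\<^bsub>thompsonF\<^esub> x0)"

lemma prodF_simps [simp]: "prodF [] = \<one>\<^bsub>thompsonF\<^esub>" "prodF (g # gs) = g \<otimes>\<^bsub>thompsonF\<^esub> prodF gs"
  by (simp_all add: prodF_def)

lemma erase_word_carrier [simp]: "erase_word w \<in> carrier thompsonF"
  by (induction w) (auto simp: word_subst_def)

lemma erase_letter:
  "replaces (inv\<^bsub>thompsonF\<^esub> x1) (True # False # False # p) (True # False # p)"
  "replaces (inv\<^bsub>thompsonF\<^esub> x1 \<otimes>\<^bsub>thompsonF\<^esub> x0) (True # False # True # p) (True # False # p)"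
  by (simp_all add: replaces_def cantor_act_mult x1_inv_acts cantor_act_x0)

lemma erase_word_replaces: "replaces (erase_word w) (True # False # w @ p) (True # False # p)"
proof (induction w)
  case Nil
  then show ?case by (simp add: word_subst_def replaces_one)
next
  case (Cons c w)
  define g where "g = (if c then inv\<^bsub>thompsonF\<^esub> x1 \<otimes>\<^bsub>thompsonF\<^esub> x0 else inv\<^bsub>thompsonF\<^esub> x1)"
  have "replaces g (True # False # c # w @ p) (True # False # w @ p)"
    using erase_letter[of "w @ p"] by (cases c) (auto simp: g_def)
  then have "replaces (g \<otimes>\<^bsub>thompsonF\<^esub> erase_word w) (True # False # c # w @ p) (True # False # p)"
    by (intro replaces_mult[OF _ _ _ Cons.IH]) (auto simp: g_def)
  then show ?case by (simp add: word_subst_def g_def)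
qed

lemma erase_word_pow_replaces:
  "replaces (erase_word w [^]\<^bsub>thompsonF\<^esub> k) (True # False # concat (replicate k w)) [True, False]"
proof (induction k)
  case 0
  then show ?case by (simp add: replaces_one)
next
  case (Suc k)
  have "replaces (erase_word w \<otimes>\<^bsub>thompsonF\<^esub> erase_word w [^]\<^bsub>thompsonF\<^esub> k)
      (True # False # w @ concat (replicate k w)) [True, False]"
    by (intro replaces_mult[OF _ _ erase_word_replaces Suc.IH]) auto
  then show ?case by (simp add: F.nat_pow_Suc2 del: F.nat_pow_Suc nat_pow_Suc)
qed

lemma stabF_subgroup: "subgroup (stabF b) thompsonF"
proof (rule F.subgroupI)
  show "stabF b \<noteq> {}" using F.one_closed cantor_act_one unfolding stabilizer_def by blast
qed (auto simp: stabilizer_def cantor_act_mult intro: cantor_act_inv_eqI)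

text \<open>The behaviour of \<open>f\<close> next to its fixed point: after lengthening a replaced prefix, its replacement starts with
  10, and the rest is a prefix of \<open>www...\<close> whose removal leaves \<open>www...\<close>.\<close>
lemma stabilizer_germ:
  assumes w: "w \<noteq> []" "\<not> proper_power w"
    and f: "f \<in> carrier thompsonF" and fixed: "cantor_act f ([True, False] @- cycle w) = [True, False] @- cycle w"
  obtains k l where "replaces f (True # False # concat (replicate k w)) (True # False # concat (replicate l w))"
proof -
  obtain m where m: "\<And>p. length p \<ge> m \<Longrightarrow> \<exists>q. replaces f p q"
    using carrier_replaces[OF f] by blast
  have len: "n \<le> length (concat (replicate n w))" for n
    using w(1) by (cases w) (simp_all add: length_concat sum_list_replicate)
  define p where "p = True # False # concat (replicate m w)"
  obtain q0 where q0: "replaces f p q0" using m[of p] len[of m] by (auto simp: p_def)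
  \<comment> \<open>two more periods make the replacement long enough to contain the prefix 10\<close>
  define q where "q = q0 @ concat (replicate 2 w)"
  have rep: "replaces f (True # False # concat (replicate (m + 2) w)) q"
    using replaces_append[OF q0, of "concat (replicate 2 w)"] 
    unfolding replicate_add concat_append p_def q_def append_Cons .
  then have "cantor_act f ((True # False # concat (replicate (m + 2) w)) @- cycle w) = q @- cycle w"
    unfolding replaces_def by blast
  then have q_eq: "q @- cycle w = True ## False ## cycle w"
    using fixed power_shift_cycle[OF w(1), of "m + 2"] by simp
  have "length q \<ge> 2" using len[of 2] by (simp add: q_def)
  then obtain a b q' where q': "q = a # b # q'" by (cases q; cases "tl q") auto
  then have ab: "a = True" "b = False" "q' @- cycle w = cycle w" using q_eq by auto
  then obtain l where "q' = concat (replicate l w)" using prefix_fixing_cycle[OF w] by blast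
  then show thesis using that rep q' ab by blast
qed

lemma stabilizer_10_cycle:
  assumes w: "w \<noteq> []" "\<not> proper_power w"
  shows "stabF ([True, False] @- cycle w) = generate thompsonF {xn 2, xn 3, y1, y2, erase_word w}"
    (is "?St = ?K")
proof
  have acts: "cantor_act h (True ## False ## u) = True ## False ## u"
    if "h \<in> {xn 2, xn 3, y1, y2}" for h u
    using that x2_acts_below(1) x3_acts_below y1_acts_below y2_acts_below
    unfolding acts_below_def by auto
  have "cantor_act (erase_word w) (True ## False ## cycle w) = True ## False ## cycle w"
    using erase_word_replaces[of w "[]"] cycle_decomp[OF w(1)] unfolding replaces_def by simp metis
  then have "{xn 2, xn 3, y1, y2, erase_word w} \<subseteq> ?St"
    using acts by (auto simp: stabilizer_def)
  then show "?K \<subseteq> ?St" by (rule F.generate_subgroup_incl[OF _ stabF_subgroup])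
next
  show "?St \<subseteq> ?K"
  proof
    fix f assume "f \<in> ?St"
    then have f: "f \<in> carrier thompsonF" "cantor_act f ([True, False] @- cycle w) = [True, False] @- cycle w"
      by (auto simp: stabilizer_def)
    obtain k l where kl: "replaces f (True # False # concat (replicate k w)) (True # False # concat (replicate l w))"
      using stabilizer_germ[OF w f] .
    \<comment> \<open>erasing \<open>w^l\<close> after and restoring \<open>w^k\<close> before \<open>f\<close> makes 10 fixed\<close>
    define P Q where "P = erase_word w [^]\<^bsub>thompsonF\<^esub> k" and "Q = erase_word w [^]\<^bsub>thompsonF\<^esub> l"
    have PQ: "P \<in> carrier thompsonF" "Q \<in> carrier thompsonF" by (simp_all add: P_def Q_def)
    define h where "h = inv\<^bsub>thompsonF\<^esub> P \<otimes>\<^bsub>thompsonF\<^esub> f \<otimes>\<^bsub>thompsonF\<^esub> Q"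
    have h: "h \<in> carrier thompsonF" using f PQ by (simp add: h_def)
    have "replaces (inv\<^bsub>thompsonF\<^esub> P) [True, False] (True # False # concat (replicate k w))"
      unfolding P_def by (intro replaces_inv erase_word_pow_replaces) simp
    then have "replaces h [True, False] [True, False]"
      unfolding h_def Q_def using f PQ kl
      by (intro replaces_mult[OF _ _ _ erase_word_pow_replaces] replaces_mult) auto
    then have "h \<in> off_10_gen" by (rule generated_if_fixes_cylinder_10[OF h])
    moreover have "off_10_gen \<subseteq> ?K" by (rule F.mono_generate) auto
    ultimately have hK: "h \<in> ?K" by blast
    have K: "subgroup ?K thompsonF" by (rule F.generate_is_subgroup) auto
    have "erase_word w \<in> ?K" by (rule generate.incl) simp
    then have "erase_word w [^]\<^bsub>thompsonF\<^esub> n \<in> ?K" for n :: nat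
      by (induction n) (simp_all add: subgroup.one_closed[OF K] subgroup.m_closed[OF K])
    then have PQK: "P \<in> ?K" "Q \<in> ?K"
      unfolding P_def Q_def by blast+
    have "f = P \<otimes>\<^bsub>thompsonF\<^esub> h \<otimes>\<^bsub>thompsonF\<^esub> inv\<^bsub>thompsonF\<^esub> Q"
      unfolding h_def using f PQ by (simp add: F.m_assoc) (simp flip: F.m_assoc)
    then show "f \<in> ?K"
      using PQK hK subgroup.m_closed[OF K] subgroup.m_inv_closed[OF K] by metis
  qed
qed

section \<open>Canonical decompositions\<close>

lemma cycle_unique:
  assumes w: "w \<noteq> []" and s: "s = w @- s"
  shows "s = cycle w"
proof (rule stream_eqI)
  have rec_s: "s !! n = (if n < length w then w ! n else s !! (n - length w))" for n
    using shift_snth[of w s n] s by simp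
  have rec_w: "cycle w !! n = (if n < length w then w ! n else cycle w !! (n - length w))" for n
    using shift_snth[of w "cycle w" n] cycle_decomp[OF w] by simp
  show "s !! n = cycle w !! n" for n
  proof (induction n rule: less_induct)
    case (less n)
    have "n - length w < n" if "\<not> n < length w" using that w by (cases w) auto
    then show ?case
      using less[of "n - length w"] unfolding rec_s[of n] rec_w[of n] by (cases "n < length w") simp_all
  qed
qed

text \<open>Two reductions terminate: replacing a proper power by its root, and moving a common last letter of the preperiod and the
  period into the period, as \<open>(v'c)(w'c)(w'c)... = v'(cw')(cw')...\<close>.\<close>
lemma canonical_decomposition_exists:
  "w \<noteq> [] \<Longrightarrow> \<exists>v' w'. canonical_decomposition (v @- cycle w) v' w'"
proof (induction "length v + length w" arbitrary: v w rule: less_induct)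
  case less
  consider "proper_power w" | "\<not> proper_power w" "v \<noteq> []" "last v = last w"
    | "\<not> proper_power w" "v \<noteq> [] \<longrightarrow> last v \<noteq> last w" by blast
  then show ?case
  proof cases
    case 1
    then obtain u k where k: "k \<ge> 2" "w = concat (replicate k u)" by (auto simp: proper_power_def)
    then have u: "u \<noteq> []" using less.prems by auto
    obtain j where j: "k = Suc (Suc j)" using k(1) by (metis Suc_le_D numeral_2_eq_2 Suc_le_mono)
    have "cycle u = w @- cycle u" using power_shift_cycle[OF u, of k] k(2) by simp
    then have "cycle w = cycle u" using cycle_unique[OF less.prems] by simp
    moreover have "length u < length w" using k(2) u j by (simp add: length_concat)
    ultimately show ?thesis using less.hyps[of v u] u by simp
  next
    case 2
    define c where "c = last w"
    have "v = butlast v @ [c]" using 2 by (simp add: c_def flip: 2(3))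
    moreover have "w = butlast w @ [c]" using less.prems by (simp add: c_def)
    ultimately have vw: "v = butlast v @ [c]" "w = butlast w @ [c]" .
    have "cycle w = butlast w @- cycle (c # butlast w)"
    proof -
      have "rotate (length (butlast w)) w = c # butlast w"
        by (subst (2) vw(2), subst rotate_append) simp
      then have "sdrop (length (butlast w)) (cycle w) = cycle (c # butlast w)"
        using sdrop_cycle[OF less.prems, of "length (butlast w)"] less.prems by simp
      moreover have "stake (length (butlast w)) (cycle w) = butlast w"
        using less.prems by (simp add: butlast_conv_take)
      ultimately show ?thesis by (metis stake_sdrop)
    qed
    then have "[c] @- cycle w = (c # butlast w) @- cycle (c # butlast w)" by simp
    also have "\<dots> = cycle (c # butlast w)" by (rule cycle_decomp[symmetric]) simp
    finally have "v @- cycle w = butlast v @- cycle (c # butlast w)"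
      by (subst vw(1)) simp
    moreover have "length (butlast v) + length (c # butlast w) < length v + length w"
      using 2 less.prems by (cases v; cases w) auto
    ultimately show ?thesis using less.hyps[of "butlast v" "c # butlast w"] by simp
  next
    case 3
    then show ?thesis using less.prems unfolding canonical_decomposition_def by blast
  qed
qed

text \<open>Far enough out, the tail of \<open>b\<close> is \<open>www...\<close> and has the period of \<open>w'\<close>.\<close>
lemma canonical_period_dvd:
  assumes "canonical_decomposition b v w" "canonical_decomposition b v' w'"
  shows "length w dvd length w'"
proof -
  have b: "b = v @- cycle w" "b = v' @- cycle w'" and w: "w \<noteq> []" "\<not> proper_power w" "w' \<noteq> []"
    using assms by (auto simp: canonical_decomposition_def)
  define N where "N = length v + length v' * length w"
  have "length v' \<le> length v' * length w" using w(1) by (cases w) simp_all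
  then have N': "length v' \<le> N" unfolding N_def by linarith
  have tail: "sdrop N b = cycle w"
    unfolding b(1) N_def using w by (simp add: sdrop_shift)
  have "sdrop N b = sdrop (N - length v') (cycle w')"
    unfolding b(2) using N' by (simp add: sdrop_shift)
  then have "sdrop (length w') (sdrop N b) = sdrop N b"
    using w(3) by (metis sdrop_add add.commute sdrop_cycle_eq)
  then show ?thesis using period_of_primitive_cycle[OF w(1,2)] tail by simp
qed

text \<open>If \<open>v'\<close> were longer than \<open>v\<close>, its last letter would lie in the periodic part and equal the last letter of \<open>w'\<close>.\<close>
lemma canonical_preperiod_le:
  assumes d: "canonical_decomposition b v w" "canonical_decomposition b v' w'"
  shows "length v' \<le> length v"
proof (rule ccontr)
  have len: "length w = length w'" using canonical_period_dvd[OF d] canonical_period_dvd[OF d(2,1)] by (rule dvd_antisym)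
  have b: "b = v @- cycle w" "b = v' @- cycle w'" and w: "w \<noteq> []" "w' \<noteq> []" and ne: "v' \<noteq> [] \<Longrightarrow> last v' \<noteq> last w'"
    using d by (auto simp: canonical_decomposition_def)
  assume "\<not> length v' \<le> length v"
  then have lt: "length v < length v'" by simp
  then have "v' \<noteq> []" by auto
  define i where "i = length v' - 1"
  have "b !! i = cycle w !! (i - length v)" unfolding b(1) using lt by (simp add: i_def)
  also have "\<dots> = sdrop (length w) (cycle w) !! (i - length v)" using w by simp
  also have "\<dots> = b !! (i + length w)" unfolding b(1) using lt by (simp add: i_def sdrop_snth add.commute)
  finally have "b !! i = b !! (i + length w')" using len by simp
  moreover have "b !! i = last v'" unfolding b(2) using \<open>v' \<noteq> []\<close> by (simp add: i_def last_conv_nth)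
  moreover have "b !! (i + length w') = last w'"
  proof -
    have "i + length w' = length v' + (length w' - 1)" using \<open>v' \<noteq> []\<close> w(2) by (cases v'; cases w') (auto simp: i_def)
    then have "b !! (i + length w') = cycle w' !! (length w' - 1)" unfolding b(2) by simp
    also have "\<dots> = (w' @- cycle w') !! (length w' - 1)" using cycle_decomp[OF w(2)] by simp
    also have "\<dots> = last w'" using w(2) by (simp add: last_conv_nth)
    finally show ?thesis .
  qed
  ultimately show False using ne \<open>v' \<noteq> []\<close> by simp
qed

lemma canonical_decomposition_unique:
  assumes d: "canonical_decomposition b v w" "canonical_decomposition b v' w'"
  shows "v = v'" "w = w'"
proof -
  have b: "b = v @- cycle w" "b = v' @- cycle w'" and w: "w \<noteq> []" "w' \<noteq> []"
    using d by (auto simp: canonical_decomposition_def)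
  have len: "length w = length w'" using canonical_period_dvd[OF d] canonical_period_dvd[OF d(2,1)] by (rule dvd_antisym)
  have lenv: "length v = length v'" using canonical_preperiod_le[OF d] canonical_preperiod_le[OF d(2,1)] by simp
  have "stake (length v) b = v" unfolding b(1) by (simp add: stake_shift)
  moreover have "stake (length v) b = v'" unfolding b(2) lenv by (simp add: stake_shift)
  ultimately show "v = v'" by simp
  then have "cycle w = cycle w'" using b by simp
  then show "w = w'" by (metis len stake_cycle_eq w)
qed

section \<open>Paths in the Schreier graph\<close>

abbreviation letters :: "(real \<Rightarrow> real) set" where
  "letters \<equiv> {x0, x1, inv\<^bsub>thompsonF\<^esub> x0, inv\<^bsub>thompsonF\<^esub> x1}"

lemma prodF_carrier: "set p \<subseteq> letters \<Longrightarrow> prodF p \<in> carrier thompsonF"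
  by (induction p) auto

lemma schreier_verts_closed:
  assumes "c \<in> schreier_verts b" "g \<in> carrier thompsonF"
  shows "cantor_act g c \<in> schreier_verts b"
proof -
  obtain f where f: "f \<in> carrier thompsonF" "c = cantor_act f b"
    using assms(1) by (auto simp: schreier_verts_def orbit_def)
  then have "cantor_act g c = cantor_act (f \<otimes>\<^bsub>thompsonF\<^esub> g) b" using assms(2) by (simp add: cantor_act_mult)
  then show ?thesis using f(1) assms(2) unfolding schreier_verts_def orbit_def by blast
qed

lemma schreier_path_word:
  "set p \<subseteq> letters \<Longrightarrow> c \<in> schreier_verts b \<Longrightarrow> schreier_path b c p (cantor_act (prodF p) c)"
proof (induction p arbitrary: c)
  case Nil
  then show ?case by (simp add: schreier_path.empty)
next
  case (Cons g p)
  have g: "g \<in> letters" "g \<in> carrier thompsonF" and p: "prodF p \<in> carrier thompsonF"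
    using Cons.prems prodF_carrier[of p] by auto
  let ?d = "cantor_act g c"
  have d: "?d \<in> schreier_verts b" using schreier_verts_closed Cons.prems(2) g(2) .
  have path: "schreier_path b ?d p (cantor_act (prodF (g # p)) c)"
    using Cons.IH[OF _ d] Cons.prems(1) g p by (simp add: cantor_act_mult)
  have "g \<in> {x0, x1} \<or> (\<exists>s\<in>{x0, x1}. g = inv\<^bsub>thompsonF\<^esub> s)" using g(1) by auto
  then consider "g \<in> {x0, x1}" | s where "s \<in> {x0, x1}" "g = inv\<^bsub>thompsonF\<^esub> s"
    by (elim disjE bexE)
  then show ?case
  proof cases
    case 1
    then have "(c, g, ?d) \<in> schreier_arrows b" using Cons.prems(2) unfolding schreier_arrows_def by blast
    then show ?thesis using path by (rule schreier_path.forward)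
  next
    case 2
    then have "cantor_act s ?d = c" by (auto simp: cantor_act_inv)
    moreover have "(?d, s, cantor_act s ?d) \<in> schreier_arrows b"
      unfolding schreier_arrows_def using d 2(1) by blast
    ultimately have "(?d, s, c) \<in> schreier_arrows b" by simp
    then show ?thesis using path unfolding 2(2) by (rule schreier_path.backward)
  qed
qed

lemma word_to_10_step:
  assumes "g \<in> letters" "replaces g v v'" "\<exists>p. set p \<subseteq> letters \<and> replaces (prodF p) v' [True, False]"
  shows "\<exists>p. set p \<subseteq> letters \<and> replaces (prodF p) v [True, False]"
proof -
  obtain p where p: "set p \<subseteq> letters" "replaces (prodF p) v' [True, False]" using assms(3) by blast
  have "replaces (prodF (g # p)) v [True, False]"
    using assms(1,2) p prodF_carrier[OF p(1)] by (auto intro!: replaces_mult)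
  then show ?thesis using assms(1) p(1) by (intro exI[of _ "g # p"]) auto
qed

text \<open>Letters behind the prefix 10 are erased by \<open>x1^-1\<close> and \<open>x1^-1 x0\<close>.\<close>
lemma word_10_to_10: "\<exists>p. set p \<subseteq> letters \<and> replaces (prodF p) (True # False # v) [True, False]"
proof (induction v)
  case Nil
  show ?case by (rule exI[of _ "[]"]) (simp add: replaces_one)
next
  case (Cons c v)
  show ?case
  proof (cases c)
    case True
    have r: "replaces (inv\<^bsub>thompsonF\<^esub> x1) (True # False # True # v) (True # True # False # v)"
      "replaces x0 (True # True # False # v) (True # False # v)"
      by (simp_all add: replaces_def x1_inv_acts cantor_act_x0)
    have "c = True" using True by simp
    show ?thesis unfolding \<open>c = True\<close>
      by (rule word_to_10_step[OF _ r(1) word_to_10_step[OF _ r(2) Cons.IH]]) auto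
  next
    case False
    show ?thesis using erase_letter(1)[of v] False by (intro word_to_10_step[OF _ _ Cons.IH]) auto
  qed
qed

text \<open>Repeated first letters are merged by \<open>x0\<close> (which shortens 11 to 1) and its inverse (which shortens 00 to 0), until the
  word starts with 10 or 01; the latter is sent to the former by \<open>x0^-1\<close>.\<close>
lemma nonconstant_word_to_10:
  assumes "x \<in> set v" "y \<in> set v" "x \<noteq> y"
  shows "\<exists>p. set p \<subseteq> letters \<and> replaces (prodF p) v [True, False]"
  using assms
proof (induction v)
  case (Cons a v)
  then obtain c v' where v: "v = c # v'" by (cases v) auto
  consider "a = c" | "a = True" "c = False" | "a = False" "c = True" by (cases a; cases c) auto
  then show ?case
  proof cases
    case 1
    then have IH: "\<exists>p. set p \<subseteq> letters \<and> replaces (prodF p) v [True, False]"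
      using Cons v by auto
    define g where "g = (if c then x0 else inv\<^bsub>thompsonF\<^esub> x0)"
    have "replaces g (a # v) v"
      unfolding v 1 g_def by (cases c) (auto simp: replaces_def cantor_act_x0 x0_inv_acts)
    then show ?thesis by (intro word_to_10_step[OF _ _ IH]) (auto simp: g_def)
  next
    case 2
    then show ?thesis using word_10_to_10 v by simp
  next
    case 3
    have "replaces (inv\<^bsub>thompsonF\<^esub> x0) (a # v) (True # False # v')"
      unfolding v 3 by (simp add: replaces_def x0_inv_acts)
    then show ?thesis by (intro word_to_10_step[OF _ _ word_10_to_10]) auto
  qed
qed simp

section \<open>Conjugate stabilizers\<close>

lemma conjF_simps:
  assumes "h \<in> carrier thompsonF" "f \<in> carrier thompsonF"
  shows "conjF f h \<in> carrier thompsonF" "cantor_act (conjF f h) u = cantor_act (inv\<^bsub>thompsonF\<^esub> h) (cantor_act f (cantor_act h u))"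
  using assms by (simp_all add: conjF_def cantor_act_mult)

lemma generate_conjF:
  assumes h: "h \<in> carrier thompsonF" and S: "S \<subseteq> carrier thompsonF" and g: "g \<in> generate thompsonF S"
  shows "conjF g h \<in> generate thompsonF ((\<lambda>s. conjF s h) ` S)"
  using g
proof (induction rule: generate.induct)
  case one
  then show ?case using h generate.one by (simp add: conjF_def)
next
  case (incl s)
  then show ?case by (intro generate.incl) blast
next
  case (inv s)
  then have "s \<in> carrier thompsonF" using S by blast
  then have "conjF (inv\<^bsub>thompsonF\<^esub> s) h = inv\<^bsub>thompsonF\<^esub> (conjF s h)"
    using h by (simp add: conjF_def F.inv_mult_group F.m_assoc)
  then show ?case using inv by (auto intro: generate.inv)
next
  case (eng s t)
  then have "s \<in> carrier thompsonF" "t \<in> carrier thompsonF" using S generate_carrier by blast+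
  then have "conjF (s \<otimes>\<^bsub>thompsonF\<^esub> t) h = conjF s h \<otimes>\<^bsub>thompsonF\<^esub> conjF t h"
    using h by (intro cantor_act_faithful) (simp_all add: conjF_simps cantor_act_mult cantor_act_inv)
  then show ?case using eng by (simp add: generate.eng)
qed

lemma stabilizer_conjugate:
  assumes h: "h \<in> carrier thompsonF" and S: "S \<subseteq> carrier thompsonF"
    and a: "stabF (cantor_act h b) = generate thompsonF S"
  shows "stabF b = generate thompsonF ((\<lambda>s. conjF s h) ` S)"
proof
  have "conjF s h \<in> stabF b" if "s \<in> S" for s
  proof -
    have "s \<in> stabF (cantor_act h b)" using a generate.incl[OF that] by simp
    then have "s \<in> carrier thompsonF" "cantor_act s (cantor_act h b) = cantor_act h b" by (auto simp: stabilizer_def)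
    then show ?thesis using h by (simp add: stabilizer_def conjF_simps cantor_act_inv)
  qed
  then show "generate thompsonF ((\<lambda>s. conjF s h) ` S) \<subseteq> stabF b"
    by (intro F.generate_subgroup_incl[OF _ stabF_subgroup]) blast
  show "stabF b \<subseteq> generate thompsonF ((\<lambda>s. conjF s h) ` S)"
  proof
    fix f assume "f \<in> stabF b"
    then have f: "f \<in> carrier thompsonF" "cantor_act f b = b" by (auto simp: stabilizer_def)
    define g where "g = conjF f (inv\<^bsub>thompsonF\<^esub> h)"
    have g: "g \<in> carrier thompsonF" using f h by (simp add: g_def conjF_simps)
    have "cantor_act g (cantor_act h b) = cantor_act h b"
      using f h by (simp add: g_def conjF_simps cantor_act_inv)
    then have "g \<in> generate thompsonF S" using a g by (simp add: stabilizer_def flip: a)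
    moreover have "conjF g h = f"
      using f h g by (intro cantor_act_faithful) (simp_all add: conjF_simps g_def cantor_act_inv)
    ultimately show "f \<in> generate thompsonF ((\<lambda>s. conjF s h) ` S)"
      using generate_conjF[OF h S, of g] by simp
  qed
qed

text \<open>A point whose preperiod and period use one letter only is constant.\<close>
lemma nonconstant_preperiod_period:
  assumes w: "w \<noteq> []" and b: "b = v @- cycle w" "b \<noteq> sconst False" "b \<noteq> sconst True"
  obtains x y where "x \<in> set (v @ w)" "y \<in> set (v @ w)" "x \<noteq> y"
proof -
  define x where "x = hd w"
  have x: "x \<in> set (v @ w)" using w by (simp add: x_def)
  have "sset b = set (v @ w)" using w b(1) by simp
  moreover have "b \<noteq> sconst x" using b by (cases x) auto
  ultimately have "set (v @ w) \<noteq> {x}" by (simp add: sconst_alt)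
  then show thesis using x that by blast
qed

lemma stabilizer_rational:
  assumes d: "canonical_decomposition b v w" and nc: "b \<noteq> sconst False" "b \<noteq> sconst True"
  shows "\<exists>h\<in>carrier thompsonF.
     (\<exists>p. schreier_path b b p ([True, False] @- cycle w) \<and> h = prodF p) \<and>
     cantor_act h b = [True, False] @- cycle w \<and>
     stabF b = generate thompsonF
       {conjF (xn 2) h, conjF (xn 3) h, conjF y1 h, conjF y2 h, conjF (erase_word w) h}"
proof -
  have b: "b = v @- cycle w" and w: "w \<noteq> []" "\<not> proper_power w"
    using d by (auto simp: canonical_decomposition_def)
  obtain p where p: "set p \<subseteq> letters" "replaces (prodF p) (v @ w) [True, False]"
    using nonconstant_preperiod_period[OF w(1) b nc] nonconstant_word_to_10 by metis
  define h where "h = prodF p"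
  have h: "h \<in> carrier thompsonF" using prodF_carrier[OF p(1)] by (simp add: h_def)
  have "b = (v @ w) @- cycle w" using b cycle_decomp[OF w(1)] by simp
  then have hb: "cantor_act h b = [True, False] @- cycle w" using p(2) by (simp only: h_def replaces_def)
  have "cantor_act \<one>\<^bsub>thompsonF\<^esub> b \<in> schreier_verts b"
    unfolding schreier_verts_def orbit_def using F.one_closed by blast
  then have "schreier_path b b p (cantor_act h b)"
    unfolding h_def by (intro schreier_path_word[OF p(1)]) simp
  moreover have "stabF b = generate thompsonF ((\<lambda>s. conjF s h) ` {xn 2, xn 3, y1, y2, erase_word w})"
    using stabilizer_10_cycle[OF w] hb by (intro stabilizer_conjugate[OF h]) auto
  ultimately show ?thesis using h hb by (intro bexI[of _ h] conjI exI[of _ p]) (auto simp: h_def)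
qed

theorem theorem1p1:
  shows
    "(\<forall>w a. w \<noteq> [] \<and> \<not> proper_power w \<and> a = [True, False] @- cycle w \<longrightarrow>
        stabF a = generate thompsonF
          {xn 2, xn 3, y1, y2,
           word_subst w (inv\<^bsub>thompsonF\<^esub> x1) (inv\<^bsub>thompsonF\<^esub> x1 \<otimes>\<^bsub>thompsonF\<^esub> x0)})
   \<and> (\<forall>b. rational_point b \<and> b \<noteq> sconst False \<and> b \<noteq> sconst True \<longrightarrow>
        (\<exists>!(v, w). canonical_decomposition b v w) \<and>
        (\<forall>v w. canonical_decomposition b v w \<longrightarrow>
          (\<exists>h\<in>carrier thompsonF.
            (\<exists>p. schreier_path b b p ([True, False] @- cycle w) \<and> h = prodF p) \<and>
            cantor_act h b = [True, False] @- cycle w \<and>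
            stabF b = generate thompsonF
              {conjF (xn 2) h, conjF (xn 3) h, conjF y1 h, conjF y2 h,
               conjF (word_subst w (inv\<^bsub>thompsonF\<^esub> x1)
                        (inv\<^bsub>thompsonF\<^esub> x1 \<otimes>\<^bsub>thompsonF\<^esub> x0)) h})))"
proof (intro conjI allI impI)
  fix w a assume "w \<noteq> [] \<and> \<not> proper_power w \<and> a = [True, False] @- cycle w"
  then show "stabF a = generate thompsonF {xn 2, xn 3, y1, y2, erase_word w}"
    using stabilizer_10_cycle by blast
next
  fix b assume "rational_point b \<and> b \<noteq> sconst False \<and> b \<noteq> sconst True"
  then obtain v w where "canonical_decomposition b v w"
    using canonical_decomposition_exists unfolding rational_point_def by blast
  then show "\<exists>!(v, w). canonical_decomposition b v w"
    using canonical_decomposition_unique by (intro ex1I[of _ "(v, w)"]) auto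
next
  fix b v w
  assume "rational_point b \<and> b \<noteq> sconst False \<and> b \<noteq> sconst True" "canonical_decomposition b v w"
  then show "\<exists>h\<in>carrier thompsonF.
     (\<exists>p. schreier_path b b p ([True, False] @- cycle w) \<and> h = prodF p) \<and>
     cantor_act h b = [True, False] @- cycle w \<and>
     stabF b = generate thompsonF
       {conjF (xn 2) h, conjF (xn 3) h, conjF y1 h, conjF y2 h, conjF (erase_word w) h}"
    using stabilizer_rational by blast
qed

end
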